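(* For every $\alpha\in[0,1]$ and every $\beta\ge 0$, the random variable $\mathbf{M}_{\alpha,\beta}$ is unimodal.
   Context: The Wright function is the entire function $\phi(\rho,\beta,z)=\sum_{n\ge 0}\frac{z^n}{n!\,\Gamma(\beta+\rho n)}$ for $\beta,z\in\mathbb{C}$, $\rho>-1$ (with $1/\Gamma$ equal to $0$ at the poles of $\Gamma$). For $\alpha\in[0,1]$ and $\beta\ge 0$, $\mathbf{M}_{\alpha,\beta}$ denotes the positive random variable whose law is determined by $$\mathbb{E}[\mathbf{M}_{\alpha,\beta}^s]=\frac{(1)_s}{(\alpha+\beta)_{\alpha s}},\qquad s>-1,$$ where $(a)_s=\Gamma(a+s)/\Gamma(a)$. Explicitly: for $\alpha\in(0,1)$ it has density $\varphi_{\alpha,\beta}(x)=\Gamma(\alpha+\beta)\,\phi(-\alpha,\beta,-x)$ on $(0,\infty)$; for $\alpha=0$ it is standard exponential for all $\beta\ge 0$; for $\alpha=1$, $\beta>0$ it has density $\beta(1-x)^{\beta-1}\mathbf{1}_{(0,1)}(x)$; and $\mathbf{M}_{1,0}=1$ almost surely. A real random variable is unimodal if there is $m\in\mathbb{R}$ such that its distribution function is convex on $(-\infty,m)$ and concave on $(m,\infty)$; if it has a density, this means that the density can be chosen non-decreasing on $(-\infty,m)$ and non-increasing on $(m,\infty)$. *)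

theory Defs
  imports "HOL-Probability.Probability"
begin

(* (a)_s = Gamma(a+s)/Gamma(a). The case s = 0 is separated because (0)_0 = 1 is
   needed below and the library sets Gamma 0 = 0, so that Gamma 0 / Gamma 0 = 0. *)
definition gen_pochhammer :: "real \<Rightarrow> real \<Rightarrow> real" where
  "gen_pochhammer a s = (if s = 0 then 1 else Gamma (a + s) / Gamma a)"

(* X, on the probability space M, is a version of the positive random variable with
   fractional moments E[X^s] = (1)_s / (\<alpha>+\<beta>)_(\<alpha> s) for all real s > -1; these
   moments determine the law of X. The requirement has_bochner_integral includes
   integrability of X^s. The zero value of x powr s at x = 0 and the junk values at
   x < 0 do not matter, since X > 0 almost surely. *)
definition is_M_variable :: "real \<Rightarrow> real \<Rightarrow> 'a measure \<Rightarrow> ('a \<Rightarrow> real) \<Rightarrow> bool" where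
  "is_M_variable \<alpha> \<beta> M X \<longleftrightarrow>
     prob_space M \<and> X \<in> borel_measurable M \<and> (AE \<omega> in M. 0 < X \<omega>) \<and>
     (\<forall>s>-1. has_bochner_integral M (\<lambda>\<omega>. X \<omega> powr s)
        (gen_pochhammer 1 s / gen_pochhammer (\<alpha> + \<beta>) (\<alpha> * s)))"

definition unimodal_law :: "real measure \<Rightarrow> bool" where
  "unimodal_law \<mu> \<longleftrightarrow> (\<exists>m. convex_on {..<m} (cdf \<mu>) \<and> concave_on {m<..} (cdf \<mu>))"

definition unimodal :: "'a measure \<Rightarrow> ('a \<Rightarrow> real) \<Rightarrow> bool" where
  "unimodal M X \<longleftrightarrow> unimodal_law (distr M borel X)"

end

theory Submission
  imports Defs
begin

text \<open>The law is approximated by laws with step densities, with values proportional to \<open>g\<^sub>n\<close> on the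
  cells \<open>(c q\<^bsup>n + 1\<^esup>, c q\<^sup>n]\<close> of a geometric grid, as \<open>q \<rightarrow> 1\<close>. Here
  \<open>\<Sum>\<^sub>n g\<^sub>n z\<^sup>n = \<Prod>\<^sub>k (1 - q\<^bsup>(k + \<beta>)/\<alpha>\<^esup> z) / (1 - q\<^sup>k z)\<close>, so that the moments are quotients of
  q-Gamma functions in the bases \<open>q\<close> and \<open>q\<^bsup>1/\<alpha>\<^esup>\<close>; they converge to the required Gamma quotients and
  satisfy a common bound \<open>k! R\<^sup>k\<close>, which gives weak convergence, and weak limits of unimodal laws are
  unimodal. For \<open>\<alpha> \<le> \<beta>\<close> the sequence \<open>g\<close> is monotone. For \<open>\<beta> < \<alpha>\<close> and \<open>b = \<beta>/\<alpha>\<close> one has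
  \<open>g\<^sub>n - g\<^bsub>n-1\<^esub> = q\<^bsup>b n\<^esup> (p\<^sub>n - p\<^bsub>n-1\<^esub>)\<close>, where \<open>p\<close> is a discrete self-decomposable sequence:
  \<open>n p\<^sub>n = \<Sum>\<^bsub>j<n\<^esub> r\<^sub>j p\<^bsub>n-1-j\<^esub>\<close> with nonincreasing \<open>r\<close>; such sequences are unimodal.\<close>

section \<open>Power series with given logarithmic derivative\<close>

text \<open>Neither the series for the density nor the Gamma quotients for the moments show the
  mode. The product in the overview is chosen because at the points \<open>z = q ^ Suc k\<close> its
  numerator and denominator become q-Pochhammer symbols in the bases
  \<open>q powr (1 / \<alpha>)\<close> and \<open>q\<close>, and these points are exactly the ones
  at which a geometric grid evaluates the generating function of \<open>g\<close> when moments are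
  taken. For \<alpha> \<le> \<beta> the increments of \<open>g\<close> are coefficients of an
  exponential of a series with nonnegative coefficients. For \<beta> < \<alpha> this fails: the
  coefficients of the logarithmic derivative of \<open>(1 - z) G(z)\<close> are negative for large
  indices. Positivity alone then says nothing, and a comparison with a self-decomposable sequence
  takes its place. Weak limits, rather than limits of densities, let one argument cover the boundary
  case \<alpha> = 1, \<beta> = 0: there \<open>g\<close> is 1, 0, 0, ... and the step density is
  uniform on (q, 1], which shrinks to the atom at 1. Only \<alpha> = 0, where
  \<open>1 / \<alpha>\<close> has no meaning, is separate; the exponential density is then its own
  approximation.\<close>

fun exp_coeff :: "(nat \<Rightarrow> real) \<Rightarrow> nat \<Rightarrow> real" where
  "exp_coeff r 0 = 1"
| "exp_coeff r (Suc n) = (\<Sum>j\<le>n. r j * exp_coeff r (n - j)) / real (Suc n)"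

declare exp_coeff.simps(2) [simp del]

lemma exp_coeff_rec:
  "real (Suc n) * exp_coeff r (Suc n) = (\<Sum>j\<le>n. r j * exp_coeff r (n - j))"
  by (simp add: exp_coeff.simps(2) del: of_nat_Suc)

text \<open>The recursion is F' = F R compared coefficientwise, so \<open>exp_coeff r\<close> lists
  the coefficients of the exponential of a primitive of R. On the level of formal series no
  convergence is involved.\<close>

lemma fps_deriv_exp_coeff:
  "fps_deriv (Abs_fps (exp_coeff r)) = Abs_fps (exp_coeff r) * Abs_fps r"
proof (rule fps_ext)
  fix n
  have "fps_nth (fps_deriv (Abs_fps (exp_coeff r))) n = (\<Sum>j\<le>n. r j * exp_coeff r (n - j))"
    using exp_coeff_rec[of n r] by simp
  also have "\<dots> = fps_nth (Abs_fps r * Abs_fps (exp_coeff r)) n"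
    by (simp add: fps_mult_nth atMost_atLeast0)
  finally show "fps_nth (fps_deriv (Abs_fps (exp_coeff r))) n = fps_nth (Abs_fps (exp_coeff r) * Abs_fps r) n"
    by (simp add: mult.commute)
qed

text \<open>A series is determined by its constant term and its logarithmic derivative;
  factorisations of generating functions thus become sums of coefficient sequences.\<close>

lemma exp_coeff_unique:
  assumes "fps_nth F 0 = 1" and "fps_deriv F = F * Abs_fps r"
  shows "F = Abs_fps (exp_coeff r)"
proof (rule fps_ext)
  fix n
  show "fps_nth F n = fps_nth (Abs_fps (exp_coeff r)) n"
  proof (induction n rule: less_induct)
    case (less n)
    show ?case
    proof (cases n)
      case 0
      with assms show ?thesis by simp
    next
      case (Suc m)
      have "real (Suc m) * fps_nth F (Suc m) = fps_nth (fps_deriv F) m"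
        by simp
      also have "\<dots> = fps_nth (Abs_fps r * F) m"
        by (simp add: assms(2) mult.commute)
      also have "\<dots> = (\<Sum>j\<le>m. r j * exp_coeff r (m - j))"
        unfolding fps_mult_nth atMost_atLeast0 using less Suc by (intro sum.cong) auto
      also have "\<dots> = real (Suc m) * exp_coeff r (Suc m)"
        by (simp add: exp_coeff_rec del: of_nat_Suc)
      finally show ?thesis
        using Suc by simp
    qed
  qed
qed

lemma exp_coeff_add:
  "Abs_fps (exp_coeff r) * Abs_fps (exp_coeff s) = Abs_fps (exp_coeff (\<lambda>j. r j + s j))"
proof (rule exp_coeff_unique)
  have "Abs_fps (\<lambda>j. r j + s j) = Abs_fps r + Abs_fps s"
    by (rule fps_ext) simp
  then show "fps_deriv (Abs_fps (exp_coeff r) * Abs_fps (exp_coeff s))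
      = Abs_fps (exp_coeff r) * Abs_fps (exp_coeff s) * Abs_fps (\<lambda>j. r j + s j)"
    by (simp add: fps_deriv_exp_coeff algebra_simps)
qed simp

text \<open>From log(1 - c z) = - sum over j of c^(j+1) z^(j+1) / (j+1). For c = 1 multiplication by
  this series is the difference operator on coefficients.\<close>

lemma exp_coeff_linear:
  "Abs_fps (exp_coeff (\<lambda>j. - (c ^ Suc j))) = 1 - fps_const c * fps_X"
proof (rule exp_coeff_unique[symmetric])
  have "(1 - fps_const c * fps_X) * Abs_fps (\<lambda>j. - (c ^ Suc j)) = fps_const (- c)"
  proof (rule fps_ext)
    fix n
    show "fps_nth ((1 - fps_const c * fps_X) * Abs_fps (\<lambda>j. - (c ^ Suc j))) n = fps_nth (fps_const (- c)) n"
      by (cases n) (simp_all add: algebra_simps)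
  qed
  then show "fps_deriv (1 - fps_const c * fps_X)
      = (1 - fps_const c * fps_X) * Abs_fps (\<lambda>j. - (c ^ Suc j))"
    by simp
qed simp

text \<open>This is the substitution of c z for z; the chain rule puts one further power of c into
  the logarithmic derivative.\<close>

lemma exp_coeff_scale:
  "exp_coeff (\<lambda>j. c ^ Suc j * r j) n = c ^ n * exp_coeff r n"
proof (induction n rule: less_induct)
  case (less n)
  show ?case
  proof (cases n)
    case (Suc m)
    have "(\<Sum>j\<le>m. c ^ Suc j * r j * exp_coeff (\<lambda>j. c ^ Suc j * r j) (m - j))
        = (\<Sum>j\<le>m. c ^ Suc m * (r j * exp_coeff r (m - j)))"
    proof (rule sum.cong)
      fix j assume "j \<in> {..m}"
      then have "c ^ Suc m = c ^ Suc j * c ^ (m - j)"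
        by (simp flip: power_add)
      moreover have "exp_coeff (\<lambda>j. c ^ Suc j * r j) (m - j) = c ^ (m - j) * exp_coeff r (m - j)"
        using less Suc by simp
      ultimately show "c ^ Suc j * r j * exp_coeff (\<lambda>j. c ^ Suc j * r j) (m - j)
          = c ^ Suc m * (r j * exp_coeff r (m - j))"
        by (simp only: mult_ac)
    qed simp
    then show ?thesis
      by (simp add: Suc exp_coeff.simps(2) sum_distrib_left)
  qed simp
qed

lemma exp_coeff_nonneg:
  assumes "\<And>j. 0 \<le> r j"
  shows "0 \<le> exp_coeff r n"
proof (induction n rule: less_induct)
  case (less n)
  then show ?case
    by (cases n) (auto simp: exp_coeff.simps(2) assms intro!: sum_nonneg divide_nonneg_nonneg mult_nonneg_nonneg)
qed

lemma exp_coeff_pos: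
  assumes "\<And>j. 0 \<le> r j" "0 < r 0"
  shows "0 < exp_coeff r n"
proof (induction n)
  case (Suc n)
  have "0 < r 0 * exp_coeff r (n - 0)"
    using assms Suc by simp
  also have "\<dots> \<le> (\<Sum>j\<le>n. r j * exp_coeff r (n - j))"
    using assms by (intro member_le_sum) (auto simp: exp_coeff_nonneg)
  finally show ?case
    by (simp add: exp_coeff.simps(2))
qed simp

section \<open>Unimodality of coefficient sequences\<close>

definition unimodal_seq :: "(nat \<Rightarrow> real) \<Rightarrow> bool" where
  "unimodal_seq g \<longleftrightarrow> (\<forall>n. g n \<le> g (Suc n)) \<or>
     (\<exists>m. (\<forall>n<m. g n \<le> g (Suc n)) \<and> (\<forall>n\<ge>m. g (Suc n) \<le> g n))"

lemma unimodal_seqE: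
  assumes "unimodal_seq g"
  obtains "incseq g" | m where "\<And>i j. i \<le> j \<Longrightarrow> j \<le> m \<Longrightarrow> g i \<le> g j" "\<And>i j. m \<le> i \<Longrightarrow> i \<le> j \<Longrightarrow> g j \<le> g i"
proof -
  consider "\<And>n. g n \<le> g (Suc n)"
    | m where "\<And>n. n < m \<Longrightarrow> g n \<le> g (Suc n)" "\<And>n. m \<le> n \<Longrightarrow> g (Suc n) \<le> g n"
    using assms unfolding unimodal_seq_def by blast
  then show thesis
  proof cases
    case 1
    then show ?thesis by (intro that incseq_SucI)
  next
    case (2 m)
    show ?thesis
    proof (rule that(2)[of m])
      show "g i \<le> g j" if "i \<le> j" "j \<le> m" for i j
        using that by (induction j rule: dec_induct) (auto intro: order_trans[OF _ 2(1)])
      show "g j \<le> g i" if "m \<le> i" "i \<le> j" for i j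
        using that(2,1) by (induction j rule: dec_induct) (auto intro: order_trans[OF 2(2)])
    qed
  qed
qed

text \<open>Unimodality depends only on the signs of the increments, and these survive
  multiplication by positive weights.\<close>

lemma unimodal_seq_transfer:
  assumes "unimodal_seq p" and w: "\<And>n. 0 < w n" "\<And>n. g (Suc n) - g n = w n * (p (Suc n) - p n)"
  shows "unimodal_seq g"
proof -
  have "g n \<le> g (Suc n) \<longleftrightarrow> p n \<le> p (Suc n)" for n
  proof -
    have "g n \<le> g (Suc n) \<longleftrightarrow> 0 \<le> w n * (p (Suc n) - p n)"
      unfolding w(2)[symmetric] by simp
    then show ?thesis
      using w(1)[of n] by (simp add: zero_le_mult_iff)
  qed
  moreover have "g (Suc n) \<le> g n \<longleftrightarrow> p (Suc n) \<le> p n" for n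
  proof -
    have "g (Suc n) \<le> g n \<longleftrightarrow> w n * (p (Suc n) - p n) \<le> 0"
      unfolding w(2)[symmetric] by simp
    then show ?thesis
      using w(1)[of n] by (simp add: mult_le_0_iff)
  qed
  ultimately show ?thesis
    using assms(1) by (simp add: unimodal_seq_def)
qed

text \<open>Here \<open>m\<close> is the first index without a strict ascent; if there is none, the
  sequence increases forever. Strong induction supplies the descent from \<open>m\<close> to
  \<open>n\<close>, so that a single further step remains to be proved.\<close>

lemma unimodal_seqI:
  assumes "\<And>m n. g (Suc m) \<le> g m \<Longrightarrow> m \<le> n \<Longrightarrow> (\<And>i. i < m \<Longrightarrow> g i \<le> g (Suc i)) \<Longrightarrow>
    (\<And>i. m \<le> i \<Longrightarrow> i < n \<Longrightarrow> g (Suc i) \<le> g i) \<Longrightarrow> g (Suc n) \<le> g n"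
  shows "unimodal_seq g"
proof (cases "\<exists>m. g (Suc m) \<le> g m")
  case False
  then show ?thesis
    unfolding unimodal_seq_def by (meson linear)
next
  case True
  define m where "m = (LEAST m. g (Suc m) \<le> g m)"
  have m: "g (Suc m) \<le> g m"
    unfolding m_def using True by (rule LeastI_ex)
  have up: "g i \<le> g (Suc i)" if "i < m" for i
    using not_less_Least[of i "\<lambda>m. g (Suc m) \<le> g m"] that unfolding m_def by linarith
  have down: "g (Suc n) \<le> g n" if "m \<le> n" for n
    using that
  proof (induction n rule: less_induct)
    case (less n)
    show ?case
      by (rule assms[of m]) (use m up less in auto)
  qed
  with up show ?thesis
    unfolding unimodal_seq_def by blast
qed

text \<open>The recursions at n + 1 and n are subtracted. If \<open>r\<close> is nonincreasing, the
  weights \<open>r j - r (Suc j)\<close> are nonnegative, and the sign of the increment is decided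
  by comparing \<open>r 0 - 1\<close> with a weighted sum of earlier values relative to the value at
  n.\<close>

lemma exp_coeff_diff:
  "real (Suc n) * (exp_coeff r (Suc n) - exp_coeff r n)
    = (r 0 - 1) * exp_coeff r n - (\<Sum>j<n. (r j - r (Suc j)) * exp_coeff r (n - 1 - j))"
proof (cases n)
  case 0
  then show ?thesis using exp_coeff_rec[of 0 r] by simp
next
  case (Suc m)
  have "real (Suc n) * exp_coeff r (Suc n)
      = r 0 * exp_coeff r n + (\<Sum>j\<le>m. r (Suc j) * exp_coeff r (m - j))"
    unfolding exp_coeff_rec by (subst Suc, subst sum.atMost_Suc_shift) (simp add: Suc)
  moreover have "real n * exp_coeff r n = (\<Sum>j\<le>m. r j * exp_coeff r (m - j))"
    using exp_coeff_rec[of m r] Suc by simp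
  moreover have "(\<Sum>j<n. (r j - r (Suc j)) * exp_coeff r (n - 1 - j))
      = (\<Sum>j\<le>m. r j * exp_coeff r (m - j)) - (\<Sum>j\<le>m. r (Suc j) * exp_coeff r (m - j))"
    by (simp add: Suc lessThan_Suc_atMost left_diff_distrib sum_subtractf)
  ultimately show ?thesis
    by (simp add: algebra_simps)
qed

text \<open>If the sequence has gone up to \<open>m\<close> and down from \<open>m\<close> to \<open>n\<close>, then looking back from the
  (lower) value at \<open>n\<close> one sees everywhere larger relative values than from \<open>m\<close>; so the negative
  part of the difference identity above cannot get weaker.\<close>

lemma unimodal_seq_exp_coeff:
  assumes dec: "\<And>j. r (Suc j) \<le> r j" and nn: "\<And>j. 0 \<le> r j"
  shows "unimodal_seq (exp_coeff r)"
proof (cases "r 0 = 0")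
  case True
  \<comment> \<open>The sequence is 1, 0, 0, ...; this degenerate case does occur, for \<alpha> = 1
    and \<beta> = 0.\<close>
  have "r j = 0" for j
    using decseqD[OF decseq_SucI[of r, OF dec], of 0 j] nn[of j] True by simp
  then have "exp_coeff r (Suc n) = 0" for n
    by (simp add: exp_coeff.simps(2))
  then show ?thesis
    using exp_coeff_nonneg[OF nn] unfolding unimodal_seq_def by auto
next
  case False
  then have pos: "0 < r 0"
    using nn[of 0] by simp
  show ?thesis
  proof (rule unimodal_seqI)
    let ?p = "exp_coeff r"
    fix m n
    assume m: "?p (Suc m) \<le> ?p m" and mn: "m \<le> n"
      and up: "\<And>i. i < m \<Longrightarrow> ?p i \<le> ?p (Suc i)"
      and down: "\<And>i. m \<le> i \<Longrightarrow> i < n \<Longrightarrow> ?p (Suc i) \<le> ?p i"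
    have p: "0 < ?p i" for i
      using nn pos by (rule exp_coeff_pos)
    have up': "?p i \<le> ?p j" if "i \<le> j" "j \<le> m" for i j
      using that by (induction j rule: dec_induct) (auto intro: order_trans[OF _ up])
    have down': "?p j \<le> ?p i" if "m \<le> i" "i \<le> j" "j \<le> n" for i j
      using that(2,1,3) by (induction j rule: dec_induct) (auto intro: order_trans[OF down])
    \<comment> \<open>If \<open>n - 1 - j\<close> has reached the descending branch, the two ratios
      lie on opposite sides of 1. Otherwise both numerators lie on the ascending branch, and
      numerators and denominators are compared separately.\<close>
    have ratio: "?p (m - 1 - j) / ?p m \<le> ?p (n - 1 - j) / ?p n" if "j < m" for j
    proof (cases "m \<le> n - 1 - j")
      case True
      have "?p (m - 1 - j) / ?p m \<le> 1"
        using up'[of "m - 1 - j" m] p[of m] by simp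
      also have "1 \<le> ?p (n - 1 - j) / ?p n"
        using down'[OF True, of n] p[of n] by simp
      finally show ?thesis .
    next
      case False
      then show ?thesis
        using that mn p
        by (intro frac_le up' down') (auto intro: less_imp_le)
    qed
    have "(r 0 - 1) \<le> (\<Sum>j<m. (r j - r (Suc j)) * (?p (m - 1 - j) / ?p m))"
    proof -
      have "(r 0 - 1) * ?p m - (\<Sum>j<m. (r j - r (Suc j)) * ?p (m - 1 - j)) \<le> 0"
        using m unfolding exp_coeff_diff[symmetric] by (intro mult_nonneg_nonpos) auto
      then have "r 0 - 1 \<le> (\<Sum>j<m. (r j - r (Suc j)) * ?p (m - 1 - j)) / ?p m"
        using p[of m] by (simp add: field_simps)
      then show ?thesis
        by (simp add: sum_divide_distrib)
    qed
    also have "\<dots> \<le> (\<Sum>j<m. (r j - r (Suc j)) * (?p (n - 1 - j) / ?p n))"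
      using dec ratio by (intro sum_mono mult_left_mono) auto
    also have "\<dots> \<le> (\<Sum>j<n. (r j - r (Suc j)) * (?p (n - 1 - j) / ?p n))"
      using dec mn p by (intro sum_mono2) (auto intro!: mult_nonneg_nonneg divide_nonneg_nonneg less_imp_le[OF p])
    finally have "r 0 - 1 \<le> (\<Sum>j<n. (r j - r (Suc j)) * ?p (n - 1 - j)) / ?p n"
      by (simp add: sum_divide_distrib)
    then have "real (Suc n) * (?p (Suc n) - ?p n) \<le> 0"
      unfolding exp_coeff_diff using p[of n] by (simp add: field_simps)
    then show "?p (Suc n) \<le> ?p n"
      by (simp add: mult_le_0_iff)
  qed
qed

text \<open>Convergence has to be proved before the differential equation can be used. The partial
  sums S are polynomials with nonnegative coefficients and satisfy S' \<le> S D, where D is the sum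
  of the \<open>r j * x ^ j\<close>; hence S exp(-L) decreases for the primitive L of D, and S \<le>
  exp L. Once the series G converges, G' = G D makes G exp(-L) constant.\<close>

lemma exp_coeff_sums:
  assumes nn: "\<And>j. 0 \<le> r j" and bd: "\<And>j. r j \<le> B" and z: "0 \<le> z" "z < 1"
  shows "(\<lambda>n. exp_coeff r n * z ^ n) sums exp (\<Sum>j. r j * z ^ Suc j / real (Suc j))"
proof -
  define D where "D = (\<lambda>x::real. \<Sum>j. r j * x ^ j)"
  define L where "L = (\<lambda>x::real. \<Sum>n. (if n = 0 then 0 else r (n - 1) / real n) * x ^ n)"
  have B: "0 \<le> B"
    using nn[of 0] bd[of 0] by linarith
  have smr: "summable (\<lambda>j. r j * x ^ j)" if "\<bar>x\<bar> < 1" for x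
  proof (rule summable_comparison_test)
    show "\<exists>N. \<forall>n\<ge>N. norm (r n * x ^ n) \<le> B * \<bar>x\<bar> ^ n"
      using nn bd by (auto simp: abs_mult power_abs intro!: mult_right_mono)
    show "summable (\<lambda>n. B * \<bar>x\<bar> ^ n)"
      using that by (intro summable_mult summable_geometric) auto
  qed
  have smL: "summable (\<lambda>n. (if n = 0 then 0 else r (n - 1) / real n) * x ^ n)" if "\<bar>x\<bar> < 1" for x
  proof (rule summable_comparison_test)
    show "\<exists>N. \<forall>n\<ge>N. norm ((if n = 0 then 0 else r (n - 1) / real n) * x ^ n) \<le> B * \<bar>x\<bar> ^ n"
    proof (intro exI allI impI)
      fix n :: nat
      have "r (n - 1) / real n \<le> B" if "n > 0"
      proof -
        have "r (n - 1) / real n \<le> B / 1"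
          using that nn bd B by (intro frac_le) auto
        then show ?thesis by simp
      qed
      then have "\<bar>if n = 0 then 0 else r (n - 1) / real n\<bar> \<le> B"
        using nn B by auto
      then show "norm ((if n = 0 then 0 else r (n - 1) / real n) * x ^ n) \<le> B * \<bar>x\<bar> ^ n"
        by (simp only: real_norm_def abs_mult power_abs) (intro mult_right_mono, auto)
    qed
    show "summable (\<lambda>n. B * \<bar>x\<bar> ^ n)"
      using that by (intro summable_mult summable_geometric) auto
  qed
  have dL: "(L has_real_derivative D x) (at x)" if "\<bar>x\<bar> < 1" for x
  proof -
    have "(L has_real_derivative (\<Sum>n. diffs (\<lambda>n. if n = 0 then 0 else r (n - 1) / real n) n * x ^ n)) (at x)"
      unfolding L_def by (rule termdiffs_strong'[of 1]) (use smL that in auto)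
    also have "(\<lambda>n. diffs (\<lambda>n. if n = 0 then 0 else r (n - 1) / real n) n) = r"
      by (auto simp: diffs_def fun_eq_iff simp del: of_nat_Suc)
    finally show ?thesis unfolding D_def .
  qed
  have L0: "L 0 = 0"
    unfolding L_def by (subst powser_zero) simp
  have part: "(\<Sum>n\<le>N. exp_coeff r n * x ^ n) \<le> exp (L x)" if x: "0 \<le> x" "x < 1" for N x
  proof -
    define S where "S = (\<lambda>x::real. \<Sum>n\<le>N. exp_coeff r n * x ^ n)"
    define S' where "S' = (\<lambda>x::real. \<Sum>n<N. real (Suc n) * exp_coeff r (Suc n) * x ^ n)"
    have dS: "(S has_real_derivative S' y) (at y)" for y
    proof -
      have "(S has_real_derivative (\<Sum>n\<le>N. exp_coeff r n * (real n * y ^ (n - 1)))) (at y)"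
        unfolding S_def by (auto intro!: derivative_eq_intros sum.cong)
      also have "(\<Sum>n\<le>N. exp_coeff r n * (real n * y ^ (n - 1))) = S' y"
        unfolding S'_def
        by (cases N) (simp, simp only: sum.atMost_Suc_shift lessThan_Suc_atMost, simp add: mult_ac)
      finally show ?thesis .
    qed
    have le: "S' y \<le> S y * D y" if y: "0 \<le> y" "y < 1" for y
    proof -
      have "S' y = (\<Sum>n<N. \<Sum>j\<le>n. (r j * y ^ j) * (exp_coeff r (n - j) * y ^ (n - j)))"
        unfolding S'_def exp_coeff_rec sum_distrib_right
        by (intro sum.cong refl) (simp add: mult_ac flip: power_add)
      also have "\<dots> = (\<Sum>(n,j)\<in>Sigma {..<N} (\<lambda>n. {..n}). (r j * y ^ j) * (exp_coeff r (n - j) * y ^ (n - j)))"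
        by (simp add: sum.Sigma)
      \<comment> \<open>Reindexing by (n - j, j) places the triangle j \<le> n < N inside a
        rectangle; the terms added there are nonnegative.\<close>
      also have "\<dots> = (\<Sum>(i,j)\<in>(\<lambda>(n,j). (n - j, j)) ` Sigma {..<N} (\<lambda>n. {..n}). (exp_coeff r i * y ^ i) * (r j * y ^ j))"
        by (subst sum.reindex) (auto simp: inj_on_def case_prod_beta mult_ac)
      also have "\<dots> \<le> (\<Sum>(i,j)\<in>{..N} \<times> {..<N}. (exp_coeff r i * y ^ i) * (r j * y ^ j))"
        using nn y by (intro sum_mono2) (auto intro!: mult_nonneg_nonneg exp_coeff_nonneg)
      also have "\<dots> = S y * (\<Sum>j<N. r j * y ^ j)"
        by (simp add: S_def sum_product sum.cartesian_product)
      also have "\<dots> \<le> S y * D y"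
        unfolding D_def using nn y
        by (intro mult_left_mono sum_le_suminf smr) (auto simp: S_def intro!: sum_nonneg exp_coeff_nonneg mult_nonneg_nonneg)
      finally show ?thesis .
    qed
    have "S x * exp (- L x) \<le> S 0 * exp (- L 0)"
    proof (rule DERIV_nonpos_imp_nonincreasing[of 0 x])
      show "\<exists>y. ((\<lambda>x. S x * exp (- L x)) has_real_derivative y) (at u) \<and> y \<le> 0" if "0 \<le> u" "u \<le> x" for u
      proof (intro exI conjI)
        show "((\<lambda>x. S x * exp (- L x)) has_real_derivative (S' u - S u * D u) * exp (- L u)) (at u)"
          using that x by (auto intro!: derivative_eq_intros dS dL simp: algebra_simps)
        show "(S' u - S u * D u) * exp (- L u) \<le> 0"
          using le[of u] that x by (simp add: mult_nonpos_nonneg)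
      qed
    qed (use x in auto)
    moreover have "S 0 = 1"
      unfolding S_def by (induction N) auto
    ultimately show ?thesis
      by (simp add: S_def L0 exp_minus field_simps)
  qed
  have smG: "summable (\<lambda>n. exp_coeff r n * x ^ n)" if "0 \<le> x" "x < 1" for x
  proof (rule summableI_nonneg_bounded)
    show "(\<Sum>i<n. exp_coeff r i * x ^ i) \<le> exp (L x)" for n
      by (rule order_trans[OF _ part[OF that, of n]])
         (use that nn in \<open>auto intro!: sum_mono2 mult_nonneg_nonneg exp_coeff_nonneg\<close>)
  qed (use nn that in \<open>auto intro!: mult_nonneg_nonneg exp_coeff_nonneg\<close>)
  have smG': "summable (\<lambda>n. exp_coeff r n * x ^ n)" if "\<bar>x\<bar> < 1" for x
    by (rule summable_norm_cancel, rule summable_cong[THEN iffD1, OF _ smG[of "\<bar>x\<bar>"]])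
       (use that nn in \<open>auto simp: abs_mult power_abs exp_coeff_nonneg\<close>)
  define G where "G = (\<lambda>x::real. \<Sum>n. exp_coeff r n * x ^ n)"
  have dG: "(G has_real_derivative G x * D x) (at x)" if "0 \<le> x" "x < 1" for x
  proof -
    have "(G has_real_derivative (\<Sum>n. diffs (exp_coeff r) n * x ^ n)) (at x)"
      unfolding G_def by (rule termdiffs_strong'[of 1]) (use smG' that in auto)
    also have "(\<Sum>n. diffs (exp_coeff r) n * x ^ n)
        = (\<Sum>n. \<Sum>j\<le>n. (r j * x ^ j) * (exp_coeff r (n - j) * x ^ (n - j)))"
      unfolding diffs_def exp_coeff_rec sum_distrib_right
      by (intro suminf_cong sum.cong refl) (simp add: mult_ac flip: power_add)
    also have "\<dots> = D x * G x"
      unfolding D_def G_def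
      by (rule Cauchy_product[symmetric])
         (use smr[of x] smG[of x] that nn in \<open>auto simp: abs_mult exp_coeff_nonneg\<close>)
    finally show ?thesis by (simp add: mult.commute)
  qed
  have "G z * exp (- L z) = G 0 * exp (- L 0)"
  proof (cases "z = 0")
    case False
    show ?thesis
    proof (rule DERIV_isconst_end[of 0 z "\<lambda>x. G x * exp (- L x)"])
      have d: "((\<lambda>x. G x * exp (- L x)) has_real_derivative 0) (at u)" if "0 \<le> u" "u \<le> z" for u
        using that z by (auto intro!: derivative_eq_intros dG dL simp: algebra_simps)
      show "continuous_on {0..z} (\<lambda>x. G x * exp (- L x))"
        by (rule DERIV_continuous_on[where D = "\<lambda>_. 0"]) (auto intro: d has_field_derivative_at_within)
      show "((\<lambda>x. G x * exp (- L x)) has_real_derivative 0) (at x)" if "0 < x" "x < z" for x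
        using d that by auto
    qed (use False z in auto)
  qed simp
  moreover have "G 0 = 1"
    unfolding G_def by (subst powser_zero) simp
  ultimately have "G z = exp (L z)"
    by (simp add: L0 exp_minus field_simps)
  moreover have "L z = (\<Sum>j. r j * z ^ Suc j / real (Suc j))"
    unfolding L_def using suminf_split_head[OF smL[of z]] z by (simp add: field_simps)
  ultimately show ?thesis
    using smG[OF z] by (simp add: G_def sums_iff)
qed

section \<open>q-Pochhammer symbols and quotients of Gamma functions\<close>

text \<open>\<open>exp (log_qpoch q x)\<close> is the reciprocal of the q-Pochhammer symbol \<open>(q\<^sup>x; q)\<^sub>\<infinity>\<close>.\<close>

definition log_qpoch :: "real \<Rightarrow> real \<Rightarrow> real" where
  "log_qpoch q x = (\<Sum>j. q powr (x * real (Suc j)) / (real (Suc j) * (1 - q ^ Suc j)))"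

lemma powr_mult_Suc: "0 < q \<Longrightarrow> q powr (x * real (Suc j)) = (q powr x) ^ Suc j"
  by (simp only: powr_realpow[symmetric] powr_gt_zero powr_powr)

lemma powr_less_one': "0 < q \<Longrightarrow> q < 1 \<Longrightarrow> 0 < x \<Longrightarrow> q powr x < (1::real)"
  by (simp add: powr_def mult_pos_neg)

lemma one_minus_power_Suc_ge:
  fixes q :: real
  assumes "0 < q" "q < 1"
  shows "1 - q \<le> real (Suc j) * (1 - q ^ Suc j)"
proof -
  have "1 * (1 - q) \<le> real (Suc j) * (1 - q ^ Suc j)"
    using assms power_Suc_le_self[of q j] by (intro mult_mono) auto
  then show ?thesis by simp
qed

lemma summable_log_qpoch:
  assumes q: "0 < q" "q < 1" and x: "0 < x"
  shows "summable (\<lambda>j. q powr (x * real (Suc j)) / (real (Suc j) * (1 - q ^ Suc j)))"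
proof (rule summable_comparison_test)
  have lt: "q powr x < 1"
    using q x by (rule powr_less_one')
  show "\<exists>N. \<forall>n\<ge>N. norm (q powr (x * real (Suc n)) / (real (Suc n) * (1 - q ^ Suc n)))
      \<le> (q powr x) ^ Suc n / (1 - q)"
  proof (intro exI allI impI)
    fix n :: nat
    have "0 < 1 - q" "1 - q \<le> real (Suc n) * (1 - q ^ Suc n)"
      using one_minus_power_Suc_ge[OF q, of n] q by auto
    then show "norm (q powr (x * real (Suc n)) / (real (Suc n) * (1 - q ^ Suc n)))
        \<le> (q powr x) ^ Suc n / (1 - q)"
      unfolding powr_mult_Suc[OF q(1)] real_norm_def abs_divide
      by (intro frac_le) (auto simp del: power_Suc of_nat_Suc)
  qed
  show "summable (\<lambda>n. (q powr x) ^ Suc n / (1 - q))"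
    using lt by (intro summable_divide summable_mult2 summable_Suc_iff[THEN iffD2] summable_geometric) auto
qed

text \<open>Each summand is a positive multiple of an exponential function of \<open>x\<close>. This
  is the q-analogue of the log-convexity of Gamma.\<close>

lemma log_qpoch_convex:
  assumes q: "0 < q" "q < 1" and x: "0 < x" "0 < y" and t: "0 \<le> t" "t \<le> 1"
  shows "log_qpoch q ((1 - t) * x + t * y) \<le> (1 - t) * log_qpoch q x + t * log_qpoch q y"
proof -
  have z: "0 < (1 - t) * x + t * y"
    using x t by (cases "t = 0") (auto intro!: add_nonneg_pos)
  have cvx: "convex_on UNIV (\<lambda>u. q powr (u * real (Suc j)))" for j
  proof (rule convex_on_realI[where f' = "\<lambda>u. q powr (u * real (Suc j)) * (real (Suc j) * ln q)"])
    fix u v :: real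
    assume "u \<le> v"
    then have "q powr (v * real (Suc j)) \<le> q powr (u * real (Suc j))"
      using q by (intro powr_mono' mult_right_mono) auto
    moreover have "real (Suc j) * ln q \<le> 0"
      using q by (intro mult_nonneg_nonpos) auto
    ultimately show "q powr (u * real (Suc j)) * (real (Suc j) * ln q)
        \<le> q powr (v * real (Suc j)) * (real (Suc j) * ln q)"
      by (rule mult_right_mono_neg)
  qed (use q in \<open>auto intro!: derivative_eq_intros simp del: of_nat_Suc\<close>)
  have "log_qpoch q ((1 - t) * x + t * y)
     \<le> (\<Sum>j. (1 - t) * (q powr (x * real (Suc j)) / (real (Suc j) * (1 - q ^ Suc j)))
          + t * (q powr (y * real (Suc j)) / (real (Suc j) * (1 - q ^ Suc j))))"
    unfolding log_qpoch_def
  proof (rule suminf_le)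
    fix j
    have "0 < real (Suc j) * (1 - q ^ Suc j)"
      using one_minus_power_Suc_ge[OF q, of j] q by linarith
    moreover have "q powr (((1 - t) * x + t * y) * real (Suc j))
        \<le> (1 - t) * q powr (x * real (Suc j)) + t * q powr (y * real (Suc j))"
      using convex_onD[OF cvx t, of x y j] by simp
    ultimately have "q powr (((1 - t) * x + t * y) * real (Suc j)) / (real (Suc j) * (1 - q ^ Suc j))
       \<le> ((1 - t) * q powr (x * real (Suc j)) + t * q powr (y * real (Suc j))) / (real (Suc j) * (1 - q ^ Suc j))"
      by (intro divide_right_mono) auto
    then show "q powr (((1 - t) * x + t * y) * real (Suc j)) / (real (Suc j) * (1 - q ^ Suc j))
       \<le> (1 - t) * (q powr (x * real (Suc j)) / (real (Suc j) * (1 - q ^ Suc j)))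
          + t * (q powr (y * real (Suc j)) / (real (Suc j) * (1 - q ^ Suc j)))"
      by (simp add: add_divide_distrib)
  qed (intro summable_log_qpoch q z summable_add summable_mult x)+
  also have "\<dots> = (1 - t) * log_qpoch q x + t * log_qpoch q y"
    unfolding log_qpoch_def
    by (simp only: suminf_add[symmetric] suminf_mult summable_mult summable_log_qpoch[OF q] x)
  finally show ?thesis .
qed

text \<open>In the difference the factor \<open>1 - q ^ Suc j\<close> cancels and the logarithmic
  series remains. It plays the part of Gamma (x + 1) = x Gamma x.\<close>

lemma log_qpoch_plus_one:
  assumes q: "0 < q" "q < 1" and x: "0 < x"
  shows "log_qpoch q x - log_qpoch q (x + 1) = - ln (1 - q powr x)"
proof -
  have lt: "0 < q powr x" "q powr x < 1"
    using q x by (auto simp add: powr_less_one')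
  have eq: "q powr (x * real (Suc j)) / (real (Suc j) * (1 - q ^ Suc j))
      - q powr ((x + 1) * real (Suc j)) / (real (Suc j) * (1 - q ^ Suc j)) = (q powr x) ^ Suc j / real (Suc j)" for j
  proof -
    have aux: "a / (n * (1 - B)) - a * B / (n * (1 - B)) = a / n" if "0 < 1 - B" "0 < n" for a B n :: real
      using that by (simp add: divide_simps) (simp add: algebra_simps)
    have "0 < 1 - q ^ Suc j"
      using power_Suc_less_one[of q j] q by simp
    moreover have "q powr ((x + 1) * real (Suc j)) = (q powr x) ^ Suc j * q ^ Suc j"
      unfolding powr_mult_Suc[OF q(1)] using q by (simp add: powr_add power_mult_distrib)
    ultimately show ?thesis
      unfolding powr_mult_Suc[OF q(1), of x] by (simp add: aux del: power_Suc of_nat_Suc)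
  qed
  have "log_qpoch q x - log_qpoch q (x + 1) = (\<Sum>j. (q powr x) ^ Suc j / real (Suc j))"
    unfolding log_qpoch_def using x by (subst suminf_diff) (auto simp only: eq intro!: summable_log_qpoch q)
  also have "\<dots> = - ln (1 - q powr x)"
  proof -
    have "ln (1 - q powr x) = (\<Sum>n. (- 1) ^ n * (1 / real (n + 1)) * ((1 - q powr x) - 1) ^ Suc n)"
      by (intro ln_series) (use lt in linarith)+
    also have "(\<lambda>n. (- 1) ^ n * (1 / real (n + 1)) * ((1 - q powr x) - 1) ^ Suc n)
        = (\<lambda>n. - ((q powr x) ^ Suc n / real (Suc n)))"
    proof
      fix n
      have "(- 1) ^ n * (- (q powr x)) ^ Suc n = - ((q powr x) ^ Suc n)"
        unfolding power_minus[of "q powr x"] by (simp flip: power_add mult.assoc)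
      then show "(- 1) ^ n * (1 / real (n + 1)) * ((1 - q powr x) - 1) ^ Suc n
          = - ((q powr x) ^ Suc n / real (Suc n))"
        by (simp add: field_simps)
    qed
    finally have *: "ln (1 - q powr x) = (\<Sum>n. - ((q powr x) ^ Suc n / real (Suc n)))" .
    have "summable (\<lambda>n. (q powr x) ^ Suc n / real (Suc n))"
      using summable_diff[OF summable_log_qpoch[OF q x] summable_log_qpoch[OF q, of "x + 1"]] x
      by (simp only: eq)
    with * show ?thesis
      by (simp add: suminf_minus)
  qed
  finally show ?thesis .
qed

text \<open>The quotient Gamma_q (x) / Gamma_q (x + t) of Jackson's q-Gamma function, in which the
  constant factor given by the q-Pochhammer symbol of q cancels.\<close>

definition qgamma_ratio :: "real \<Rightarrow> real \<Rightarrow> real \<Rightarrow> real" where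
  "qgamma_ratio q x t = (1 - q) powr t * exp (log_qpoch q x - log_qpoch q (x + t))"

lemma log_qpoch_plus_nat:
  assumes q: "0 < q" "q < 1" and x: "0 < x"
  shows "exp (log_qpoch q (x + real n) - log_qpoch q x) = (\<Prod>k<n. 1 - q powr (x + real k))"
proof (induction n)
  case (Suc n)
  have "log_qpoch q (x + real n + 1) = log_qpoch q (x + real n) + ln (1 - q powr (x + real n))"
    using log_qpoch_plus_one[OF q, of "x + real n"] x by simp
  moreover have "q powr (x + real n) < 1"
    using q x by (simp add: powr_less_one')
  ultimately have "exp (log_qpoch q (x + real (Suc n)) - log_qpoch q x)
      = exp ((log_qpoch q (x + real n) - log_qpoch q x) + ln (1 - q powr (x + real n)))"
    by (simp add: add_ac)
  also have "\<dots> = exp (log_qpoch q (x + real n) - log_qpoch q x) * (1 - q powr (x + real n))"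
    using \<open>q powr (x + real n) < 1\<close> by (simp add: exp_add)
  finally show ?case
    using Suc by simp
qed simp

text \<open>The Bohr--Mollerup argument: the increment over \<open>[x + n + 1, x + n + 1 + t]\<close> is squeezed by
  convexity between the unit increments to the left and to the right.\<close>

lemma qgamma_ratio_bounds:
  fixes q x t :: real and n :: nat
  assumes q: "0 < q" "q < 1" and x: "0 < x" and t: "0 \<le> t" "t \<le> 1"
  defines "b \<equiv> \<lambda>y. ((1 - q) / (1 - q powr y)) powr t
      * (\<Prod>k<Suc n. (1 - q powr (x + t + real k)) / (1 - q powr (x + real k)))"
  shows "b (x + real (Suc n)) \<le> qgamma_ratio q x t" and "qgamma_ratio q x t \<le> b (x + real n)"
proof -
  define y where "y = x + real (Suc n)"
  define P where "P = (\<Prod>k<Suc n. (1 - q powr (x + t + real k)) / (1 - q powr (x + real k)))"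
  have y: "1 < y" "0 < y"
    using x by (auto simp: y_def)
  have P: "0 \<le> P"
    unfolding P_def using q x t by (intro prod_nonneg divide_nonneg_nonneg) (auto intro!: less_imp_le[OF powr_less_one'])
  \<comment> \<open>The functional equation moves the increment from \<open>x\<close> to
    \<open>y = x + n + 1\<close> at the price of the finite product \<open>P\<close>, whose limit as
    q tends to 1 is elementary for fixed \<open>n\<close>.\<close>
  have "exp (log_qpoch q x - log_qpoch q (x + t))
      = exp (log_qpoch q y - log_qpoch q (y + t)) * (exp (log_qpoch q (x + t + real (Suc n)) - log_qpoch q (x + t))
          / exp (log_qpoch q (x + real (Suc n)) - log_qpoch q x))"
    by (simp add: y_def add_ac flip: exp_add exp_diff)
  also have "\<dots> = exp (log_qpoch q y - log_qpoch q (y + t)) * P"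
    using x t by (simp only: log_qpoch_plus_nat[OF q] P_def prod_dividef)
  finally have ratio: "qgamma_ratio q x t = (1 - q) powr t * exp (log_qpoch q y - log_qpoch q (y + t)) * P"
    by (simp add: qgamma_ratio_def)
  have pw: "((1 - q) / (1 - q powr z)) powr t = (1 - q) powr t * exp (- t * ln (1 - q powr z))"
    if "0 < z" for z
  proof -
    define w where "w = 1 - q powr z"
    have "0 < w"
      using powr_less_one'[OF q that] by (simp add: w_def)
    then have "((1 - q) / w) powr t = (1 - q) powr t * exp (- t * ln w)"
      using q by (simp add: powr_divide powr_def[of w] exp_minus field_simps)
    then show ?thesis
      by (simp only: w_def)
  qed
  have "log_qpoch q (y + t) \<le> (1 - t) * log_qpoch q y + t * log_qpoch q (y + 1)"
    using log_qpoch_convex[OF q, of y "y + 1" t] y t by (simp add: algebra_simps)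
  then have "t * (log_qpoch q y - log_qpoch q (y + 1)) \<le> log_qpoch q y - log_qpoch q (y + t)"
    by (simp add: algebra_simps)
  then have lo: "- t * ln (1 - q powr y) \<le> log_qpoch q y - log_qpoch q (y + t)"
    unfolding log_qpoch_plus_one[OF q y(2)] by simp
  show "b (x + real (Suc n)) \<le> qgamma_ratio q x t"
    unfolding ratio b_def P_def[symmetric] y_def[symmetric] pw[OF y(2)]
    using P lo by (intro mult_right_mono mult_left_mono) auto
  \<comment> \<open>For the upper bound \<open>y\<close> is written as a convex combination of
    \<open>y - 1\<close> and \<open>y + t\<close>; multiplying the convexity inequality by
    \<open>1 + t\<close> then isolates the increment over [y, y + t].\<close>
  have conv: "(1 - 1 / (1 + t)) * (y - 1) + 1 / (1 + t) * (y + t) = y"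
    using t by (simp add: divide_simps) (simp add: algebra_simps)
  have "log_qpoch q y \<le> (1 - 1 / (1 + t)) * log_qpoch q (y - 1) + 1 / (1 + t) * log_qpoch q (y + t)"
    using log_qpoch_convex[OF q, of "y - 1" "y + t" "1 / (1 + t)"] y t unfolding conv by simp
  then have "(1 + t) * log_qpoch q y \<le> (1 + t) * ((1 - 1 / (1 + t)) * log_qpoch q (y - 1) + 1 / (1 + t) * log_qpoch q (y + t))"
    using t by (intro mult_left_mono) auto
  also have "\<dots> = t * log_qpoch q (y - 1) + log_qpoch q (y + t)"
    using t by (simp add: divide_simps)
  finally have "log_qpoch q y - log_qpoch q (y + t) \<le> t * (log_qpoch q (y - 1) - log_qpoch q (y - 1 + 1))"
    by (simp add: algebra_simps)
  then have up: "log_qpoch q y - log_qpoch q (y + t) \<le> - t * ln (1 - q powr (y - 1))"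
    using log_qpoch_plus_one[OF q, of "y - 1"] y by simp
  have y1: "x + real n = y - 1"
    by (simp add: y_def)
  have y1_pos: "0 < y - 1"
    using y by simp
  show "qgamma_ratio q x t \<le> b (x + real n)"
    unfolding ratio b_def P_def[symmetric] y1 pw[OF y1_pos]
    using P up by (intro mult_right_mono mult_left_mono) auto
qed

section \<open>The limit q -> 1 and a bound uniform in q\<close>

lemma tendsto_q_number: "((\<lambda>q. (1 - q powr y) / (1 - q)) \<longlongrightarrow> y) (at_left 1)" for y :: real
proof -
  have "((\<lambda>q. q powr y) has_real_derivative y) (at 1)"
    by (auto intro!: derivative_eq_intros)
  then have "((\<lambda>q. (q powr y - 1) / (q - 1)) \<longlongrightarrow> y) (at 1)"
    by (simp add: has_field_derivative_iff)
  then have "((\<lambda>q. (q powr y - 1) / (q - 1)) \<longlongrightarrow> y) (at_left 1)"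
    by (rule tendsto_mono[rotated]) (simp add: at_le)
  moreover have "(q powr y - 1) / (q - 1) = (1 - q powr y) / (1 - q)" for q
    by (metis minus_diff_eq minus_divide_divide)
  ultimately show ?thesis
    by simp
qed

lemma tendsto_q_number_ratio:
  assumes "0 < z"
  shows "((\<lambda>q. (1 - q powr y) / (1 - q powr z)) \<longlongrightarrow> y / z) (at_left (1::real))"
proof -
  have "((\<lambda>q. ((1 - q powr y) / (1 - q)) / ((1 - q powr z) / (1 - q))) \<longlongrightarrow> y / z) (at_left 1)"
    using assms by (intro tendsto_divide tendsto_q_number) auto
  moreover have "\<forall>\<^sub>F q in at_left (1::real). q \<noteq> 1"
    by (simp add: eventually_at_filter)
  ultimately show ?thesis
    by (elim Lim_transform_eventually) (auto elim!: eventually_mono)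
qed

text \<open>The quotient of the product formulas for 1/Gamma at \<open>x + t\<close> and at
  \<open>x\<close>. The shift \<open>d\<close> changes the power of n only by a factor tending to 1;
  its values 1 and 0 belong to the lower and the upper bound in
  \<open>qgamma_ratio_bounds\<close>.\<close>

lemma pochhammer_ratio_LIMSEQ:
  assumes x: "0 < x" and t: "0 \<le> t"
  shows "(\<lambda>n. (1 / (x + real n + d)) powr t * (\<Prod>k<Suc n. (x + t + real k) / (x + real k)))
      \<longlonglongrightarrow> Gamma x / Gamma (x + t)"
proof -
  have nz: "x \<notin> \<int>\<^sub>\<le>\<^sub>0" "x + t \<notin> \<int>\<^sub>\<le>\<^sub>0"
    using x t by (auto elim!: nonpos_Ints_cases)
  have "(\<lambda>n. rGamma_series (x + t) n / rGamma_series x n) \<longlonglongrightarrow> rGamma (x + t) / rGamma x"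
    using nz by (intro tendsto_intros) (auto simp: rGamma_eq_zero_iff)
  moreover have "(\<lambda>n. (real n / (x + real n + d)) powr t) \<longlonglongrightarrow> 1 powr t"
  proof (rule tendsto_powr)
    have "(\<lambda>n. 1 / ((x + d) / real n + 1)) \<longlonglongrightarrow> 1 / (0 + 1)"
      by (intro tendsto_intros lim_const_over_n) auto
    moreover have "\<forall>\<^sub>F n in sequentially. 1 / ((x + d) / real n + 1) = real n / (x + real n + d)"
      using eventually_gt_at_top[of 0] by eventually_elim (simp add: divide_simps add_ac)
    ultimately show "(\<lambda>n. real n / (x + real n + d)) \<longlonglongrightarrow> 1"
      by (simp add: tendsto_cong)
  qed simp_all
  ultimately have "(\<lambda>n. rGamma_series (x + t) n / rGamma_series x n * (real n / (x + real n + d)) powr t)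
      \<longlonglongrightarrow> rGamma (x + t) / rGamma x * 1 powr t"
    by (rule tendsto_mult)
  also have "rGamma (x + t) / rGamma x * 1 powr t = Gamma x / Gamma (x + t)"
    by (simp add: rGamma_inverse_Gamma field_simps)
  finally have "(\<lambda>n. rGamma_series (x + t) n / rGamma_series x n * (real n / (x + real n + d)) powr t)
      \<longlonglongrightarrow> Gamma x / Gamma (x + t)" .
  moreover have "\<forall>\<^sub>F n in sequentially. rGamma_series (x + t) n / rGamma_series x n * (real n / (x + real n + d)) powr t
     = (1 / (x + real n + d)) powr t * (\<Prod>k<Suc n. (x + t + real k) / (x + real k))"
    using eventually_gt_at_top[of 0] eventually_gt_at_top[of "nat \<lceil>\<bar>d\<bar>\<rceil>"]
  proof eventually_elim
    case (elim n)
    then have n: "0 < real n" "0 < x + real n + d"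
      using x by linarith+
    have "exp ((x + t) * ln (real n)) = exp (x * ln (real n)) * real n powr t"
      using n by (simp add: powr_def ring_distribs exp_add)
    moreover have "(\<Prod>k<Suc n. (x + t + real k) / (x + real k)) = pochhammer (x + t) (n + 1) / pochhammer x (n + 1)"
      by (simp add: pochhammer_prod prod_dividef atLeast0LessThan del: prod.lessThan_Suc)
    ultimately show ?case
      using n by (simp add: rGamma_series_def powr_divide del: prod.lessThan_Suc)
  qed
  ultimately show ?thesis
    by (rule Lim_transform_eventually)
qed

text \<open>No interchange of limits is required: for a given \<open>a\<close> first
  \<open>n\<close> is fixed so that the limit of the bound is on the right side of \<open>a\<close>,
  and only then does q tend to 1.\<close>

lemma qgamma_ratio_tendsto:
  assumes x: "0 < x" and t: "0 \<le> t" "t \<le> 1"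
  shows "((\<lambda>q. qgamma_ratio q x t) \<longlongrightarrow> Gamma x / Gamma (x + t)) (at_left 1)"
proof (rule order_tendstoI)
  define b where "b = (\<lambda>d n q. ((1 - q) / (1 - q powr (x + real n + d))) powr t
      * (\<Prod>k<Suc n. (1 - q powr (x + t + real k)) / (1 - q powr (x + real k))))"
  define c where "c = (\<lambda>d n. (1 / (x + real n + d)) powr t * (\<Prod>k<Suc n. (x + t + real k) / (x + real k)))"
  have b: "(b d n \<longlongrightarrow> c d n) (at_left 1)" if "0 \<le> d" for d n
    unfolding b_def c_def
  proof (intro tendsto_mult tendsto_prod tendsto_powr tendsto_q_number_ratio)
    show "((\<lambda>q. (1 - q) / (1 - q powr (x + real n + d))) \<longlongrightarrow> 1 / (x + real n + d)) (at_left 1)"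
    proof (rule Lim_transform_eventually)
      show "((\<lambda>q. (1 - q powr 1) / (1 - q powr (x + real n + d))) \<longlongrightarrow> 1 / (x + real n + d)) (at_left 1)"
        using x that by (intro tendsto_q_number_ratio) auto
      show "\<forall>\<^sub>F q in at_left 1. (1 - q powr 1) / (1 - q powr (x + real n + d)) = (1 - q) / (1 - q powr (x + real n + d))"
        using eventually_at_left_real[of 0 "1::real"] by (auto elim!: eventually_mono)
    qed
  qed (use x that in auto)
  have c: "c d \<longlonglongrightarrow> Gamma x / Gamma (x + t)" for d
    unfolding c_def using x t(1) by (rule pochhammer_ratio_LIMSEQ)
  have ev: "\<forall>\<^sub>F q in at_left 1. 0 < q \<and> q < (1::real)"
    using eventually_at_left_real[of 0 "1::real"] by (auto elim!: eventually_mono)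
  fix a
  {
    assume "a < Gamma x / Gamma (x + t)"
    then have "\<exists>n. a < c 1 n"
      using order_tendstoD(1)[OF c] eventually_happens sequentially_bot by metis
    then obtain n where "a < c 1 n" ..
    then have "\<forall>\<^sub>F q in at_left 1. a < b 1 n q"
      using order_tendstoD(1)[OF b] by auto
    with ev show "\<forall>\<^sub>F q in at_left 1. a < qgamma_ratio q x t"
    proof eventually_elim
      case (elim q)
      then show ?case
        using qgamma_ratio_bounds(1)[of q x t n] x t by (simp add: b_def add_ac del: prod.lessThan_Suc)
    qed
  next
    assume "Gamma x / Gamma (x + t) < a"
    then have "\<exists>n. c 0 n < a"
      using order_tendstoD(2)[OF c] eventually_happens sequentially_bot by metis
    then obtain n where "c 0 n < a" ..
    then have "\<forall>\<^sub>F q in at_left 1. b 0 n q < a"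
      using order_tendstoD(2)[OF b] by auto
    with ev show "\<forall>\<^sub>F q in at_left 1. qgamma_ratio q x t < a"
    proof eventually_elim
      case (elim q)
      then show ?case
        using qgamma_ratio_bounds(2)[of q x t n] x t by (simp add: b_def del: prod.lessThan_Suc)
    qed
  }
qed

lemma qgamma_ratio_nonneg: "0 \<le> qgamma_ratio q x t"
  by (simp add: qgamma_ratio_def)

lemma one_minus_powr_ge:
  assumes q: "0 < q" "q < 1" and t: "0 \<le> t" "t \<le> (1::real)"
  shows "t * (1 - q) \<le> 1 - q powr t"
proof -
  have "exp ((1 - t) * 0 + t * ln q) \<le> (1 - t) * exp 0 + t * exp (ln q)"
    using convex_onD[OF exp_convex t, of 0 "ln q"] by simp
  then show ?thesis
    using q by (simp add: powr_def algebra_simps)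
qed

text \<open>The upper bound for n = 0 has two factors. Convexity of the exponential bounds the first
  by 1/t; as t \<le> x, the second is at most 1 + q^x \<le> 2. The result does not depend on q or x
  and is the source of the growth rate 2/\<alpha> of the moments.\<close>

lemma qgamma_ratio_le:
  assumes q: "0 < q" "q < 1" and t: "0 < t" "t \<le> 1" and x: "t \<le> x"
  shows "qgamma_ratio q x t \<le> 2 / t"
proof -
  have x0: "0 < x"
    using t x by simp
  have lt: "q powr x < 1"
    using powr_less_one'[OF q x0] .
  have "t * (1 - q) \<le> 1 - q powr t"
    using one_minus_powr_ge[OF q] t by simp
  also have "\<dots> \<le> 1 - q powr x"
    using powr_mono'[OF x, of q] q by simp
  finally have "(1 - q) / (1 - q powr x) \<le> 1 / t"
    using t lt by (simp add: field_simps)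
  then have "((1 - q) / (1 - q powr x)) powr t \<le> (1 / t) powr t"
    using q lt t by (intro powr_mono2) auto
  also have "\<dots> \<le> (1 / t) powr 1"
    using t by (intro powr_mono) auto
  finally have 1: "((1 - q) / (1 - q powr x)) powr t \<le> 1 / t"
    using t by simp
  have "1 - q powr (x + t) \<le> 1 - q powr (x + x)"
    using powr_mono'[of "x + t" "x + x" q] q x by simp
  also have "\<dots> = (1 - q powr x) * (1 + q powr x)"
    unfolding powr_add by (simp add: algebra_simps)
  also have "\<dots> \<le> (1 - q powr x) * 2"
    using lt by (intro mult_left_mono) auto
  finally have 2: "(1 - q powr (x + t)) / (1 - q powr x) \<le> 2"
    using lt by (simp add: field_simps)
  have "qgamma_ratio q x t \<le> ((1 - q) / (1 - q powr x)) powr t * ((1 - q powr (x + t)) / (1 - q powr x))"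
    using qgamma_ratio_bounds(2)[OF q x0, of t 0] t by simp
  also have "\<dots> \<le> 1 / t * 2"
    using 1 2 t lt powr_less_one'[OF q, of "x + t"] x0
    by (intro mult_mono) (auto intro!: divide_nonneg_nonneg)
  finally show ?thesis
    by simp
qed

section \<open>The method of moments\<close>

text \<open>It bounds (n+k)! R^(n+k) |h|^k / k! by n! (2R)^n (2R|h|)^k, so the Taylor series of the
  n-th derivative converges geometrically with a step length independent of n.\<close>

lemma fact_add_le: "fact (n + k) \<le> (2::real) ^ (n + k) * fact n * fact k"
proof -
  have "fact n * fact k * ((n + k) choose n) = fact (n + k)"
    using binomial_fact_lemma[of n "n + k"] by simp
  then have "(fact (n + k) :: real) = fact n * fact k * real ((n + k) choose n)"
    by (metis of_nat_fact of_nat_mult)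
  also have "\<dots> \<le> fact n * fact k * 2 ^ (n + k)"
  proof (rule mult_left_mono)
    show "real ((n + k) choose n) \<le> 2 ^ (n + k)"
      using binomial_le_pow2[of "n + k" n] by (metis of_nat_le_iff of_nat_numeral of_nat_power)
  qed simp
  finally show ?thesis
    by (simp add: mult_ac)
qed

text \<open>Up to the factor \<open>\<i> ^ n\<close> this is the n-th derivative of the
  characteristic function at \<open>t\<close>; as an integral it can be handled without
  differentiating.\<close>

definition char_moment :: "real measure \<Rightarrow> nat \<Rightarrow> real \<Rightarrow> complex" where
  "char_moment M n t = (\<integral>x. of_real (x ^ n) * iexp (t * x) \<partial>M)"

text \<open>The exponential series of exp(i h x) is integrated term by term. The restriction on
  \<open>h\<close> gives 2R|h| \<le> 1/2, whence the ratio 1/2 in a dominating series that involves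
  neither \<open>t\<close> nor the law beyond \<open>R\<close>.\<close>

lemma char_moment_sums:
  assumes M: "real_distribution M"
    and int: "\<And>k. integrable M (\<lambda>x. x ^ k)"
    and bd: "\<And>k. (\<integral>x. \<bar>x\<bar> ^ k \<partial>M) \<le> fact k * R ^ k"
    and R: "0 < R" and h: "\<bar>h\<bar> \<le> 1 / (4 * R)"
  shows "(\<lambda>k. (\<i> * of_real h) ^ k / fact k * char_moment M (n + k) t) sums char_moment M n (t + h)"
    and "norm ((\<i> * of_real h) ^ k / fact k * char_moment M (n + k) t) \<le> fact n * (2 * R) ^ n * (1 / 2) ^ k"
proof -
  interpret real_distribution M by (rule M)
  have int': "integrable M (\<lambda>x. complex_of_real (x ^ k) * iexp (t * x))" for k
    using int[of k] by (rule Bochner_Integration.integrable_bound) (auto simp: norm_mult norm_power power_abs)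
  have norm_le: "\<bar>h\<bar> ^ k / fact k * (\<integral>x. \<bar>x\<bar> ^ (n + k) \<partial>M) \<le> fact n * (2 * R) ^ n * (1 / 2) ^ k" for k
  proof -
    have "\<bar>h\<bar> ^ k / fact k * (\<integral>x. \<bar>x\<bar> ^ (n + k) \<partial>M)
        \<le> (1 / (4 * R)) ^ k / fact k * ((2 ^ (n + k) * fact n * fact k) * R ^ (n + k))"
    proof (rule mult_mono)
      show "\<bar>h\<bar> ^ k / fact k \<le> (1 / (4 * R)) ^ k / fact k"
        using h by (intro divide_right_mono power_mono) auto
      have "(\<integral>x. \<bar>x\<bar> ^ (n + k) \<partial>M) \<le> fact (n + k) * R ^ (n + k)"
        by (rule bd)
      also have "\<dots> \<le> (2 ^ (n + k) * fact n * fact k) * R ^ (n + k)"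
        using R by (intro mult_right_mono fact_add_le) simp
      finally show "(\<integral>x. \<bar>x\<bar> ^ (n + k) \<partial>M) \<le> (2 ^ (n + k) * fact n * fact k) * R ^ (n + k)" .
    qed (use R in \<open>simp_all add: integral_nonneg_AE\<close>)
    also have "\<dots> = fact n * (2 * R) ^ n * (1 / 2) ^ k"
    proof -
      have "(1 / (4 * R)) ^ k * (2 * R) ^ k = (1 / 2) ^ k"
        using R by (subst power_mult_distrib[symmetric]) simp
      moreover have "(1 / (4 * R)) ^ k / fact k * ((2 ^ (n + k) * fact n * fact k) * R ^ (n + k))
          = fact n * (2 * R) ^ n * ((1 / (4 * R)) ^ k * (2 * R) ^ k)"
        by (simp add: power_add power_mult_distrib)
      ultimately show ?thesis
        by simp
    qed
    finally show ?thesis .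
  qed
  have cm_le: "norm (char_moment M k t) \<le> (\<integral>x. \<bar>x\<bar> ^ k \<partial>M)" for k
    unfolding char_moment_def
    by (rule order_trans[OF integral_norm_bound]) (simp add: norm_mult norm_power power_abs)
  show "norm ((\<i> * of_real h) ^ k / fact k * char_moment M (n + k) t) \<le> fact n * (2 * R) ^ n * (1 / 2) ^ k"
    using mult_left_mono[OF cm_le[of "n + k"], of "\<bar>h\<bar> ^ k / fact k"] norm_le[of k]
    by (simp add: norm_mult norm_divide norm_power)
  define f where "f = (\<lambda>k x. (\<i> * of_real h) ^ k / fact k * (complex_of_real (x ^ (n + k)) * iexp (t * x)))"
  have f_int: "integrable M (f k)" for k
    unfolding f_def by (intro integrable_mult_right int')
  have f_sums: "(\<lambda>k. f k x) sums (of_real (x ^ n) * iexp ((t + h) * x))" for x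
  proof -
    have "(\<lambda>k. (of_real (x ^ n) * iexp (t * x)) * ((\<i> * of_real (h * x)) ^ k /\<^sub>R fact k))
       sums ((of_real (x ^ n) * iexp (t * x)) * exp (\<i> * of_real (h * x)))"
      by (intro sums_mult exp_converges)
    moreover have "(of_real (x ^ n) * iexp (t * x)) * ((\<i> * of_real (h * x)) ^ k /\<^sub>R fact k) = f k x" for k
      unfolding f_def by (simp add: scaleR_conv_of_real power_mult_distrib power_add divide_inverse mult_ac)
    moreover have "iexp (t * x) * exp (\<i> * of_real (h * x)) = iexp ((t + h) * x)"
      by (simp add: algebra_simps flip: exp_add)
    ultimately show ?thesis
      by (simp add: mult.assoc)
  qed
  have f_norm: "norm (f k x) = \<bar>h\<bar> ^ k / fact k * \<bar>x\<bar> ^ (n + k)" for k x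
    unfolding f_def by (simp add: norm_mult norm_divide norm_power power_abs)
  have f_summable: "summable (\<lambda>k. norm (f k x))" for x
  proof -
    have "summable (\<lambda>k. \<bar>x\<bar> ^ n * ((\<bar>h\<bar> * \<bar>x\<bar>) ^ k /\<^sub>R fact k))"
      by (intro summable_mult) (rule sums_summable[OF exp_converges])
    moreover have "\<bar>x\<bar> ^ n * ((\<bar>h\<bar> * \<bar>x\<bar>) ^ k /\<^sub>R fact k) = norm (f k x)" for k
      unfolding f_norm by (simp add: power_mult_distrib power_add divide_inverse mult_ac)
    ultimately show ?thesis by (simp only:)
  qed
  have int_summable: "summable (\<lambda>k. \<integral>x. norm (f k x) \<partial>M)"
  proof (rule summable_comparison_test)
    show "\<exists>N. \<forall>k\<ge>N. norm (\<integral>x. norm (f k x) \<partial>M) \<le> fact n * (2 * R) ^ n * (1 / 2) ^ k"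
    proof (intro exI allI impI)
      fix k
      have "(\<integral>x. norm (f k x) \<partial>M) = \<bar>h\<bar> ^ k / fact k * (\<integral>x. \<bar>x\<bar> ^ (n + k) \<partial>M)"
        unfolding f_norm by (rule integral_mult_right_zero)
      moreover have "0 \<le> (\<integral>x. norm (f k x) \<partial>M)"
        by (rule integral_nonneg_AE) simp
      ultimately show "norm (\<integral>x. norm (f k x) \<partial>M) \<le> fact n * (2 * R) ^ n * (1 / 2) ^ k"
        using norm_le[of k] by (simp only: real_norm_def abs_of_nonneg)
    qed
  qed (intro summable_mult summable_geometric, simp)
  have "(\<lambda>k. integral\<^sup>L M (f k)) sums (\<integral>x. (\<Sum>k. f k x) \<partial>M)"
    using f_int f_summable int_summable by (intro sums_integral) auto
  moreover have "(\<Sum>k. f k x) = of_real (x ^ n) * iexp ((t + h) * x)" for x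
    using f_sums by (simp add: sums_iff)
  moreover have "integral\<^sup>L M (f k) = (\<i> * of_real h) ^ k / fact k * char_moment M (n + k) t" for k
    unfolding f_def char_moment_def by (rule integral_mult_right_zero)
  ultimately show "(\<lambda>k. (\<i> * of_real h) ^ k / fact k * char_moment M (n + k) t) sums char_moment M n (t + h)"
    by (simp add: char_moment_def)
qed

text \<open>Convergence of the derivatives of the characteristic functions at \<open>0\<close> is carried along the
  whole line by steps of Taylor expansions with a common radius of convergence.\<close>

theorem method_of_moments:
  fixes M :: "nat \<Rightarrow> real measure"
  assumes M: "\<And>N. real_distribution (M N)" and M': "real_distribution M'"
    and int: "\<And>N k. integrable (M N) (\<lambda>x. x ^ k)" and int': "\<And>k. integrable M' (\<lambda>x. x ^ k)"
    and bd: "\<And>N k. (\<integral>x. \<bar>x\<bar> ^ k \<partial>M N) \<le> fact k * R ^ k"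
    and bd': "\<And>k. (\<integral>x. \<bar>x\<bar> ^ k \<partial>M') \<le> fact k * R ^ k"
    and lim: "\<And>k. (\<lambda>N. \<integral>x. x ^ k \<partial>M N) \<longlonglongrightarrow> (\<integral>x. x ^ k \<partial>M')"
    and R: "0 < R"
  shows "weak_conv_m M M'"
proof (rule levy_continuity[OF M M'])
  fix t :: real
  \<comment> \<open>So many steps that each has length at most 1/(4R); the summand 1 keeps
    \<open>m\<close> positive at \<open>t = 0\<close>.\<close>
  define m where "m = nat \<lceil>4 * R * \<bar>t\<bar>\<rceil> + 1"
  define h where "h = t / real m"
  have m: "0 < m" "4 * R * \<bar>t\<bar> \<le> real m"
    unfolding m_def by linarith+
  have h: "\<bar>h\<bar> \<le> 1 / (4 * R)"
    using m R unfolding h_def by (simp add: field_simps)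
  have "(\<lambda>N. char_moment (M N) n (real j * h)) \<longlonglongrightarrow> char_moment M' n (real j * h)" for j n
  \<comment> \<open>All orders \<open>n\<close> are carried along, because one Taylor step uses
    every derivative at the preceding point.\<close>
  proof (induction j arbitrary: n)
    case 0
    have "char_moment L n 0 = of_real (\<integral>x. x ^ n \<partial>L)" for L
      unfolding char_moment_def by (simp flip: integral_complex_of_real)
    with tendsto_of_real[OF lim[of n]] show ?case
      by simp
  next
    case (Suc j)
    let ?a = "\<lambda>k N. (\<i> * of_real h) ^ k / fact k * char_moment (M N) (n + k) (real j * h)"
    let ?b = "\<lambda>k. (\<i> * of_real h) ^ k / fact k * char_moment M' (n + k) (real j * h)"
    \<comment> \<open>The dominating geometric series is the same for all \<open>N\<close>, as
      \<open>R\<close> is common to all the laws; this permits the exchange of limit and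
      sum.\<close>
    have "(\<lambda>N. \<Sum>k. ?a k N) \<longlonglongrightarrow> (\<Sum>k. ?b k)"
    proof (rule tannerys_theorem[THEN conjunct2, THEN conjunct2])
      show "(\<lambda>N. ?a k N) \<longlonglongrightarrow> ?b k" for k
        by (intro tendsto_intros Suc)
      show "\<forall>\<^sub>F (k, N) in sequentially \<times>\<^sub>F sequentially. norm (?a k N) \<le> fact n * (2 * R) ^ n * (1 / 2) ^ k"
        by (intro always_eventually) (use char_moment_sums(2)[OF M int bd R h] in auto)
      show "summable (\<lambda>k. fact n * (2 * R) ^ n * (1 / 2) ^ k)"
        by (intro summable_mult summable_geometric) simp
    qed simp
    moreover have "(\<Sum>k. ?a k N) = char_moment (M N) n (real j * h + h)" for N
      using char_moment_sums(1)[OF M int bd R h] by (simp add: sums_iff)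
    moreover have "(\<Sum>k. ?b k) = char_moment M' n (real j * h + h)"
      using char_moment_sums(1)[OF M' int' bd' R h] by (simp add: sums_iff)
    ultimately show ?case
      by (simp add: algebra_simps)
  qed
  from this[of 0 m] show "(\<lambda>N. char (M N) t) \<longlonglongrightarrow> char M' t"
    using m by (simp add: h_def char_moment_def char_def)
qed

section \<open>Unimodal laws and their weak limits\<close>

text \<open>At an intermediate point z the number \<open>f z\<close> separates the slope of the
  chord on the left from that on the right. Thus \<open>f\<close> serves as a subgradient, and the
  jumps of a step density do no harm.\<close>

lemma convex_on_if_monotone_slopes:
  fixes F f :: "real \<Rightarrow> real"
  assumes S: "convex S"
    and le: "\<And>x z. x \<in> S \<Longrightarrow> z \<in> S \<Longrightarrow> x < z \<Longrightarrow> F z - F x \<le> f z * (z - x)"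
    and ge: "\<And>x z. x \<in> S \<Longrightarrow> z \<in> S \<Longrightarrow> x < z \<Longrightarrow> f x * (z - x) \<le> F z - F x"
  shows "convex_on S F"
proof (rule convex_on_linorderI[OF _ S])
  fix t x y :: real
  assume t: "0 < t" "t < 1" and xy: "x \<in> S" "y \<in> S" "x < y"
  define z where "z = (1 - t) * x + t * y"
  have z: "z \<in> S"
    unfolding z_def using S xy t by (intro convexD[OF S, of x y "1 - t" t, simplified]) auto
  have zx: "z - x = t * (y - x)" "y - z = (1 - t) * (y - x)"
    by (simp_all add: z_def algebra_simps)
  have "x < z" "z < y"
    using zx t xy by (smt (verit) mult_pos_pos)+
  then have "F z - F x \<le> f z * (t * (y - x))" "f z * ((1 - t) * (y - x)) \<le> F y - F z"
    using le[of x z] ge[of z y] xy z unfolding zx by auto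
  then have "(1 - t) * (F z - F x) \<le> (1 - t) * (f z * (t * (y - x)))"
    "t * (f z * ((1 - t) * (y - x))) \<le> t * (F y - F z)"
    using t by (intro mult_left_mono; simp)+
  then have "(1 - t) * (F z - F x) \<le> t * (F y - F z)"
    by (simp add: algebra_simps)
  then have "F z \<le> (1 - t) * F x + t * F y"
    by (simp add: algebra_simps)
  then show "F ((1 - t) *\<^sub>R x + t *\<^sub>R y) \<le> (1 - t) * F x + t * F y"
    by (simp add: z_def)
qed

lemma unimodal_law_density:
  fixes f :: "real \<Rightarrow> real"
  assumes D: "real_distribution (density lborel f)" and f: "\<And>x. 0 \<le> f x" "f \<in> borel_measurable borel"
    and up: "\<And>x y. x \<le> y \<Longrightarrow> y < m \<Longrightarrow> f x \<le> f y"
    and down: "\<And>x y. m < x \<Longrightarrow> x \<le> y \<Longrightarrow> f y \<le> f x"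
  shows "convex_on {..<m} (cdf (density lborel f))" and "concave_on {m<..} (cdf (density lborel f))"
proof -
  let ?M = "density lborel f"
  interpret real_distribution ?M by (rule D)
  have incr: "ennreal (cdf ?M z - cdf ?M x) = (\<integral>\<^sup>+u. ennreal (f u) * indicator {x<..z} u \<partial>lborel)"
    if "x < z" for x z
    using emeasure_Ioc[of x z] that f by (simp add: emeasure_density)
  have le: "cdf ?M z - cdf ?M x \<le> c * (z - x)"
    if "x < z" "0 \<le> c" "AE u in lborel. x < u \<and> u \<le> z \<longrightarrow> f u \<le> c" for x z c
  proof -
    have "ennreal (cdf ?M z - cdf ?M x) \<le> (\<integral>\<^sup>+u. ennreal c * indicator {x<..z} u \<partial>lborel)"
      unfolding incr[OF that(1)] using that(3)
      by (intro nn_integral_mono_AE) (auto intro: ennreal_leI split: split_indicator)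
    also have "\<dots> = ennreal (c * (z - x))"
      using that by (simp add: nn_integral_cmult ennreal_mult)
    finally show ?thesis
      using that by (subst (asm) ennreal_le_iff) auto
  qed
  have ge: "c * (z - x) \<le> cdf ?M z - cdf ?M x"
    if "x < z" "0 \<le> c" "AE u in lborel. x < u \<and> u \<le> z \<longrightarrow> c \<le> f u" for x z c
  proof -
    have "ennreal (c * (z - x)) = (\<integral>\<^sup>+u. ennreal c * indicator {x<..z} u \<partial>lborel)"
      using that by (simp add: nn_integral_cmult ennreal_mult)
    also have "\<dots> \<le> ennreal (cdf ?M z - cdf ?M x)"
      unfolding incr[OF that(1)] using that(3)
      by (intro nn_integral_mono_AE) (auto intro: ennreal_leI split: split_indicator)
    finally show ?thesis
      using cdf_nondecreasing[of x z] that by (subst (asm) ennreal_le_iff) auto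
  qed
  show "convex_on {..<m} (cdf ?M)"
    by (rule convex_on_if_monotone_slopes[of _ _ f]) (use up f in \<open>auto intro!: le ge\<close>)
  have "convex_on {m<..} (\<lambda>x. - cdf ?M x)"
  proof (rule convex_on_if_monotone_slopes[of _ _ "\<lambda>x. - f x"])
    fix x z assume *: "x \<in> {m<..}" "z \<in> {m<..}" "x < z"
    show "- cdf ?M z - - cdf ?M x \<le> - f z * (z - x)"
      using ge[of x z "f z"] down[of _ z] * f by auto
    show "- f x * (z - x) \<le> - cdf ?M z - - cdf ?M x"
      using le[of x z "f x"] down[of x] * f by auto
  qed simp
  then show "concave_on {m<..} (cdf ?M)"
    by (simp add: concave_on_def)
qed

text \<open>Weak convergence controls distribution functions only at continuity points of the limit,
  and the three points of a convexity inequality may be atoms. A common shift by e > 0 keeps their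
  affine relation; all e outside a countable set avoid atoms, small e stay in the open set
  \<open>S\<close>, and right continuity allows e to tend to 0. The sign \<open>s\<close> treats
  convexity and concavity together, and the inequality is asked only eventually because the modes
  vary with \<open>N\<close>.\<close>

lemma cdf_convex_limit:
  fixes M :: "nat \<Rightarrow> real measure"
  assumes M': "real_distribution M'" and conv: "weak_conv_m M M'"
    and I: "open S" "convex S"
    and ev: "\<And>x y t. x \<in> S \<Longrightarrow> y \<in> S \<Longrightarrow> 0 < t \<Longrightarrow> t < 1 \<Longrightarrow> \<forall>\<^sub>F N in sequentially.
       s * cdf (M N) ((1 - t) * x + t * y) \<le> (1 - t) * (s * cdf (M N) x) + t * (s * cdf (M N) y)"
  shows "convex_on S (\<lambda>x. s * cdf M' x)"
proof (rule convex_onI[OF _ I(2)])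
  interpret real_distribution M' by (rule M')
  fix t x y :: real
  assume t: "0 < t" "t < 1" and xy: "x \<in> S" "y \<in> S"
  let ?z = "(1 - t) * x + t * y"
  let ?F = "cdf M'"
  obtain d where d: "0 < d" "\<And>e. \<bar>e\<bar> < d \<Longrightarrow> x + e \<in> S \<and> y + e \<in> S"
  proof -
    obtain d1 d2 where "0 < d1" "ball x d1 \<subseteq> S" "0 < d2" "ball y d2 \<subseteq> S"
      using I(1) xy open_contains_ball by metis
    then show thesis
      by (intro that[of "min d1 d2"]) (auto simp: subset_iff dist_real_def)
  qed
  define C where "C = (\<lambda>a. {e. measure M' {a + e} > 0})"
  have "countable (C a)" for a
  proof -
    have "countable ((\<lambda>u. u - a) ` {u. measure M' {u} > 0})"
      using countable_atoms by blast
    moreover have "C a \<subseteq> (\<lambda>u. u - a) ` {u. measure M' {u} > 0}"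
      unfolding C_def by (auto intro: image_eqI[where x = "a + e" for e])
    ultimately show ?thesis
      by (rule countable_subset[rotated])
  qed
  then have count: "countable (C x \<union> C y \<union> C ?z)"
    by simp
  have ineq: "s * ?F (?z + e) \<le> (1 - t) * (s * ?F (x + e)) + t * (s * ?F (y + e))"
    if e: "\<bar>e\<bar> < d" "e \<notin> C x \<union> C y \<union> C ?z" for e
  proof (rule tendsto_le[OF sequentially_bot])
    have cont: "isCont ?F (x + e)" "isCont ?F (y + e)" "isCont ?F (?z + e)"
      using e by (auto simp: C_def isCont_cdf zero_less_measure_iff)
    then have lims: "(\<lambda>N. cdf (M N) (x + e)) \<longlonglongrightarrow> ?F (x + e)" "(\<lambda>N. cdf (M N) (y + e)) \<longlonglongrightarrow> ?F (y + e)"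
       "(\<lambda>N. cdf (M N) (?z + e)) \<longlonglongrightarrow> ?F (?z + e)"
      using conv by (auto simp: weak_conv_m_def weak_conv_def)
    show "(\<lambda>N. s * cdf (M N) (?z + e)) \<longlonglongrightarrow> s * ?F (?z + e)"
      by (intro tendsto_intros lims)
    show "(\<lambda>N. (1 - t) * (s * cdf (M N) (x + e)) + t * (s * cdf (M N) (y + e)))
        \<longlonglongrightarrow> (1 - t) * (s * ?F (x + e)) + t * (s * ?F (y + e))"
      by (intro tendsto_intros lims)
    have "(1 - t) * (x + e) + t * (y + e) = ?z + e"
      by (simp add: algebra_simps)
    then show "\<forall>\<^sub>F N in sequentially. s * cdf (M N) (?z + e)
        \<le> (1 - t) * (s * cdf (M N) (x + e)) + t * (s * cdf (M N) (y + e))"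
      using ev[of "x + e" "y + e" t] d(2)[OF e(1)] t by simp
  qed
  have "\<exists>e. 0 < e \<and> e < min d (1 / real (Suc k)) \<and> e \<notin> C x \<union> C y \<union> C ?z" for k
  proof -
    have "uncountable {0<..<min d (1 / real (Suc k))}"
      using d by (subst uncountable_open_interval) auto
    then have "uncountable ({0<..<min d (1 / real (Suc k))} - (C x \<union> C y \<union> C ?z))"
      using count by (rule uncountable_minus_countable)
    then have "{0<..<min d (1 / real (Suc k))} - (C x \<union> C y \<union> C ?z) \<noteq> {}"
      by (metis countable_empty)
    then show ?thesis by auto
  qed
  then obtain e where e: "\<And>k. 0 < e k" "\<And>k. e k < d" "\<And>k. e k < 1 / real (Suc k)"
      "\<And>k. e k \<notin> C x \<union> C y \<union> C ?z"
    by (metis min_less_iff_conj)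
  have e0: "e \<longlonglongrightarrow> 0"
    by (rule tendsto_sandwich[OF _ _ tendsto_const LIMSEQ_inverse_real_of_nat])
       (auto intro!: always_eventually less_imp_le[OF e(1)] less_imp_le[OF e(3)] simp: inverse_eq_divide simp del: of_nat_Suc)
  have F: "(\<lambda>k. ?F (a + e k)) \<longlonglongrightarrow> ?F a" for a
  proof -
    have "filterlim (\<lambda>k. a + e k) (at_right a) sequentially"
      unfolding filterlim_at using less_imp_neq[OF e(1), symmetric] e(1) tendsto_add[OF tendsto_const[of a] e0]
      by (auto intro!: always_eventually)
    moreover have "(?F \<longlongrightarrow> ?F a) (at_right a)"
      using cdf_is_right_cont by (simp add: continuous_within)
    ultimately show ?thesis
      by (rule filterlim_compose[rotated])
  qed
  have "s * ?F ?z \<le> (1 - t) * (s * ?F x) + t * (s * ?F y)"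
  proof (rule tendsto_le[OF sequentially_bot])
    show "(\<lambda>k. s * ?F (?z + e k)) \<longlonglongrightarrow> s * ?F ?z"
      by (intro tendsto_intros F)
    show "(\<lambda>k. (1 - t) * (s * ?F (x + e k)) + t * (s * ?F (y + e k)))
        \<longlonglongrightarrow> (1 - t) * (s * ?F x) + t * (s * ?F y)"
      by (intro tendsto_intros F)
    show "\<forall>\<^sub>F k in sequentially. s * ?F (?z + e k) \<le> (1 - t) * (s * ?F (x + e k)) + t * (s * ?F (y + e k))"
      by (intro always_eventually allI ineq) (use e in \<open>auto simp: abs_of_pos\<close>)
  qed
  then show "s * ?F ((1 - t) *\<^sub>R x + t *\<^sub>R y) \<le> (1 - t) * (s * ?F x) + t * (s * ?F y)"
    by simp
qed

lemma weak_conv_m_subseq: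
  "weak_conv_m M M' \<Longrightarrow> strict_mono r \<Longrightarrow> weak_conv_m (M \<circ> r) M'"
  unfolding weak_conv_m_def weak_conv_def by (auto intro: LIMSEQ_subseq_LIMSEQ[unfolded o_def])

text \<open>The modes stay bounded: by convexity a law on the positive half-line with mode \<open>m\<close> gives
  mass at most \<open>1/2\<close> to \<open>(0, m/2]\<close>.\<close>

theorem unimodal_law_weak_limit:
  fixes M :: "nat \<Rightarrow> real measure"
  assumes M: "\<And>N. real_distribution (M N)" and M': "real_distribution M'" and conv: "weak_conv_m M M'"
    and m: "\<And>N. 0 \<le> m N" and zero: "\<And>N. cdf (M N) 0 = 0"
    and cvx: "\<And>N. convex_on {..<m N} (cdf (M N))" and ccv: "\<And>N. concave_on {m N<..} (cdf (M N))"
  shows "unimodal_law M'"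
proof -
  interpret M': real_distribution M' by (rule M')
  have half: "cdf (M N) x \<le> 1 / 2" if "0 < x" "2 * x < m N" for x N
  proof -
    interpret MN: real_distribution "M N" by (rule M)
    have "cdf (M N) ((1 - 1/2) *\<^sub>R 0 + (1/2) *\<^sub>R (2 * x)) \<le> (1 - 1/2) * cdf (M N) 0 + 1/2 * cdf (M N) (2 * x)"
      using that by (intro convex_onD[OF cvx]) auto
    then show ?thesis
      using zero[of N] MN.cdf_bounded_prob[of "2 * x"] by simp
  qed
  \<comment> \<open>At this point weak convergence applies and the limit value exceeds 1/2; by
    \<open>half\<close> the modes are then eventually at most \<open>2 * x\<close>.\<close>
  obtain x where x: "0 < x" "isCont (cdf M') x" "1 / 2 < cdf M' x"
  proof -
    have "\<forall>\<^sub>F x in at_top. 1 / 2 < cdf M' x"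
      using order_tendstoD(1)[OF M'.cdf_lim_at_top_prob, of "1/2"] by simp
    then obtain a where a: "\<And>x. a \<le> x \<Longrightarrow> 1 / 2 < cdf M' x"
      by (auto simp: eventually_at_top_linorder)
    have "uncountable {max a 0<..<max a 0 + 1}"
      by (subst uncountable_open_interval) auto
    then have "uncountable ({max a 0<..<max a 0 + 1} - {x. measure M' {x} > 0})"
      using M'.countable_atoms by (rule uncountable_minus_countable)
    then have "{max a 0<..<max a 0 + 1} - {x. measure M' {x} > 0} \<noteq> {}"
      by (metis countable_empty)
    then obtain x where "x \<in> {max a 0<..<max a 0 + 1} - {x. measure M' {x} > 0}"
      by blast
    with a show thesis
      by (intro that[of x]) (auto simp: M'.isCont_cdf measure_le_0_iff not_less)
  qed
  have "(\<lambda>N. cdf (M N) x) \<longlonglongrightarrow> cdf M' x"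
    using conv x by (auto simp: weak_conv_m_def weak_conv_def)
  then have "\<forall>\<^sub>F N in sequentially. 1 / 2 < cdf (M N) x"
    using x by (intro order_tendstoD(1))
  then obtain N0 where "\<And>N. N0 \<le> N \<Longrightarrow> 1 / 2 < cdf (M N) x"
    by (auto simp: eventually_sequentially)
  then have "m (N + N0) \<le> 2 * x" for N
    using half[OF x(1), of "N + N0"] by (meson add.commute le_add2 not_less)
  then have "bounded (range (\<lambda>N. m (N + N0)))"
    using m by (intro boundedI[where B = "2 * x"]) auto
  then obtain l r where r: "strict_mono r" and l: "((\<lambda>N. m (N + N0)) \<circ> r) \<longlonglongrightarrow> l"
    using bounded_imp_convergent_subsequence by blast
  define r' where "r' = (\<lambda>N. r N + N0)"
  have r': "strict_mono r'" and l': "(\<lambda>N. m (r' N)) \<longlonglongrightarrow> l"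
    using r l by (auto simp: r'_def strict_mono_def o_def)
  have conv': "weak_conv_m (M \<circ> r') M'"
    using conv r' by (rule weak_conv_m_subseq)
  \<comment> \<open>Two points strictly below the limit \<open>l\<close> of the modes are eventually
    below the modes themselves; likewise above.\<close>
  have "convex_on {..<l} (\<lambda>x. 1 * cdf M' x)"
  proof (rule cdf_convex_limit[OF M' conv'])
    fix x y t :: real
    assume xy: "x \<in> {..<l}" "y \<in> {..<l}" and t: "0 < t" "t < 1"
    have "\<forall>\<^sub>F N in sequentially. max x y < m (r' N)"
      using order_tendstoD(1)[OF l', of "max x y"] xy by simp
    then show "\<forall>\<^sub>F N in sequentially. 1 * cdf ((M \<circ> r') N) ((1 - t) * x + t * y)
        \<le> (1 - t) * (1 * cdf ((M \<circ> r') N) x) + t * (1 * cdf ((M \<circ> r') N) y)"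
    proof eventually_elim
      case (elim N)
      then show ?case
        using convex_onD[OF cvx[of "r' N"], of t x y] t by simp
    qed
  qed auto
  moreover have "convex_on {l<..} (\<lambda>x. -1 * cdf M' x)"
  proof (rule cdf_convex_limit[OF M' conv'])
    fix x y t :: real
    assume xy: "x \<in> {l<..}" "y \<in> {l<..}" and t: "0 < t" "t < 1"
    have "\<forall>\<^sub>F N in sequentially. m (r' N) < min x y"
      using order_tendstoD(2)[OF l', of "min x y"] xy by simp
    then show "\<forall>\<^sub>F N in sequentially. -1 * cdf ((M \<circ> r') N) ((1 - t) * x + t * y)
        \<le> (1 - t) * (-1 * cdf ((M \<circ> r') N) x) + t * (-1 * cdf ((M \<circ> r') N) y)"
    proof eventually_elim
      case (elim N)
      then show ?case
        using concave_onD[OF ccv[of "r' N"], of t x y] t by simp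
    qed
  qed auto
  ultimately show ?thesis
    unfolding unimodal_law_def concave_on_def by auto
qed

section \<open>The approximating sequences\<close>

lemma sinh_mult_ge:
  fixes c u :: real
  assumes c: "1 \<le> c" and u: "0 \<le> u"
  shows "c * sinh u \<le> sinh (c * u)"
proof -
  have "sinh (c * 0) - c * sinh 0 \<le> sinh (c * u) - c * sinh u"
  proof (rule DERIV_nonneg_imp_nondecreasing[OF u])
    fix x :: real
    assume x: "0 \<le> x" "x \<le> u"
    have "x \<le> c * x"
      using mult_right_mono[OF c x(1)] by simp
    then have "0 \<le> c * (cosh (c * x) - cosh x)"
      using c x by (simp add: cosh_real_nonneg_le_iff)
    moreover have "((\<lambda>x. sinh (c * x) - c * sinh x) has_real_derivative c * (cosh (c * x) - cosh x)) (at x)"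
      by (auto intro!: derivative_eq_intros simp: algebra_simps)
    ultimately show "\<exists>y. ((\<lambda>x. sinh (c * x) - c * sinh x) has_real_derivative y) (at x) \<and> 0 \<le> y"
      by blast
  qed
  then show ?thesis by simp
qed

lemma exp_minus_one_squared: "(exp x - 1)\<^sup>2 = 4 * exp x * (sinh (x / 2))\<^sup>2" for x :: real
proof -
  have "exp x - 1 = 2 * exp (x / 2) * sinh (x / 2)"
    by (simp add: sinh_field_def algebra_simps flip: exp_add)
  moreover have "(exp (x / 2))\<^sup>2 = exp x"
    by (simp flip: exp_double)
  ultimately show ?thesis
    by (simp add: power_mult_distrib)
qed

text \<open>The derivatives of the two parts are compared with the same quantity 1/(4 sinh(u/2)^2).
  The first is at most its negative, since convexity gives exp((1-b)u) \<le> b + (1-b) exp u; the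
  second equals c/(4 sinh(cu/2)^2) and is at most this quantity, since sinh(cu/2) \<ge> c sinh(u/2)
  and c \<ge> 1. Equality holds for b = 0, c = 1, where \<open>K\<close> vanishes.\<close>

lemma levy_kernel_antimono:
  fixes b c x y :: real
  defines "K \<equiv> \<lambda>x. exp (b * x) / (exp x - 1) - 1 / (exp (c * x) - 1)"
  assumes b: "0 \<le> b" "b \<le> 1" and c: "1 \<le> c" and xy: "0 < x" "x \<le> y"
  shows "K y \<le> K x"
proof (rule DERIV_nonpos_imp_nonincreasing[OF xy(2)])
  fix u assume "x \<le> u" "u \<le> y"
  then have u: "0 < u" "0 < c * u"
    using xy c by auto
  have gt: "1 < exp u" "1 < exp (c * u)"
    using u by auto
  define d1 where "d1 = (b * exp (b * u) * (exp u - 1) - exp (b * u) * exp u) / (exp u - 1)\<^sup>2"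
  define d2 where "d2 = c * exp (c * u) / (exp (c * u) - 1)\<^sup>2"
  have "((\<lambda>x. exp (b * x) / (exp x - 1)) has_real_derivative d1) (at u)"
    unfolding d1_def power2_eq_square using gt by (auto intro!: derivative_eq_intros simp: mult_ac)
  moreover have "((\<lambda>x. 1 / (exp (c * x) - 1)) has_real_derivative - d2) (at u)"
    unfolding d2_def power2_eq_square using gt by (auto intro!: derivative_eq_intros simp: mult_ac)
  ultimately have "(K has_real_derivative d1 - - d2) (at u)"
    unfolding K_def by (rule DERIV_diff)
  then have "(K has_real_derivative d1 + d2) (at u)"
    by simp
  moreover have "d1 + d2 \<le> 0"
  proof -
    have "exp ((1 - (1 - b)) * 0 + (1 - b) * u) \<le> (1 - (1 - b)) * exp 0 + (1 - b) * exp u"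
      using convex_onD[OF exp_convex, of "1 - b" 0 u] b by simp
    then have "exp ((1 - b) * u) \<le> b + (1 - b) * exp u"
      by simp
    then have "exp (b * u) * exp ((1 - b) * u) \<le> exp (b * u) * (b + (1 - b) * exp u)"
      by (intro mult_left_mono) auto
    then have "exp u \<le> exp (b * u) * exp u - b * exp (b * u) * (exp u - 1)"
      by (simp add: algebra_simps flip: exp_add)
    then have "d1 \<le> - exp u / (exp u - 1)\<^sup>2"
      unfolding d1_def by (intro divide_right_mono) auto
    also have "\<dots> = - (1 / (4 * (sinh (u / 2))\<^sup>2))"
      unfolding exp_minus_one_squared by simp
    finally have 1: "d1 \<le> - (1 / (4 * (sinh (u / 2))\<^sup>2))" .
    have pos: "0 < sinh (u / 2)" "0 < sinh (c * (u / 2))"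
      using u by (auto simp: sinh_real_pos_iff)
    have "c * (sinh (u / 2))\<^sup>2 \<le> c\<^sup>2 * (sinh (u / 2))\<^sup>2"
      using c by (intro mult_right_mono) (auto simp: power2_eq_square)
    also have "\<dots> \<le> (sinh (c * (u / 2)))\<^sup>2"
      using sinh_mult_ge[OF c, of "u / 2"] pos c u
      by (simp add: power_mono flip: power_mult_distrib)
    finally have "c / (sinh (c * (u / 2)))\<^sup>2 \<le> 1 / (sinh (u / 2))\<^sup>2"
      using pos by (simp add: divide_simps)
    moreover have "d2 = c / (4 * (sinh (c * (u / 2)))\<^sup>2)"
      unfolding d2_def exp_minus_one_squared by simp
    ultimately have "d2 \<le> 1 / (4 * (sinh (u / 2))\<^sup>2)"
      by simp
    with 1 show ?thesis by simp
  qed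
  ultimately show "\<exists>d. (K has_real_derivative d) (at u) \<and> d \<le> 0"
    by blast
qed

text \<open>The coefficients of the logarithmic derivative of \<open>\<Prod>\<^sub>k (1 - q\<^bsup>(k + \<beta>)/\<alpha>\<^esup> z) / (1 - q\<^sup>k z)\<close>.\<close>

definition levy_coeff :: "real \<Rightarrow> real \<Rightarrow> real \<Rightarrow> nat \<Rightarrow> real" where
  "levy_coeff \<alpha> \<beta> q j = 1 / (1 - q ^ Suc j) - (q powr (\<beta> / \<alpha>)) ^ Suc j / (1 - (q powr (1 / \<alpha>)) ^ Suc j)"

lemma powr_frac_bounds:
  assumes \<alpha>: "0 < \<alpha>" "\<alpha> \<le> 1" and q: "0 < q" "q < (1::real)"
  shows "0 < q powr (1 / \<alpha>)" "q powr (1 / \<alpha>) \<le> q" "q powr (1 / \<alpha>) < 1"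
proof -
  show "q powr (1 / \<alpha>) \<le> q"
    using powr_mono'[of 1 "1 / \<alpha>" q] \<alpha> q by simp
  with q show "0 < q powr (1 / \<alpha>)" "q powr (1 / \<alpha>) < 1"
    by auto
qed

lemma levy_coeff_bounds:
  assumes \<alpha>: "0 < \<alpha>" "\<alpha> \<le> 1" and \<beta>: "0 \<le> \<beta>" and q: "0 < q" "q < 1"
  shows "0 \<le> levy_coeff \<alpha> \<beta> q j" and "levy_coeff \<alpha> \<beta> q j \<le> 1 / (1 - q)"
proof -
  let ?p = "q powr (1 / \<alpha>)"
  note p = powr_frac_bounds[OF \<alpha> q]
  have pp: "?p ^ Suc j \<le> q ^ Suc j" "q ^ Suc j < 1"
    using p q power_Suc_less_one[of q j] by (auto intro!: power_mono simp del: power_Suc)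
  have b: "(q powr (\<beta> / \<alpha>)) ^ Suc j \<le> 1"
    using powr_mono'[of 0 "\<beta> / \<alpha>" q] \<alpha> \<beta> q by (intro power_le_one) auto
  have "(q powr (\<beta> / \<alpha>)) ^ Suc j / (1 - ?p ^ Suc j) \<le> 1 / (1 - q ^ Suc j)"
    using b pp by (intro frac_le) auto
  then show "0 \<le> levy_coeff \<alpha> \<beta> q j"
    by (simp add: levy_coeff_def)
  have "0 \<le> (q powr (\<beta> / \<alpha>)) ^ Suc j / (1 - ?p ^ Suc j)"
    using pp by (intro divide_nonneg_nonneg) auto
  moreover have "1 / (1 - q ^ Suc j) \<le> 1 / (1 - q)"
    using q power_Suc_le_self[of q j] by (intro frac_le) (auto simp del: power_Suc)
  ultimately show "levy_coeff \<alpha> \<beta> q j \<le> 1 / (1 - q)"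
    unfolding levy_coeff_def by linarith
qed

text \<open>Differencing multiplies the generating function by 1 - z, and the logarithmic derivative
  of 1 - z has all coefficients equal to -1.\<close>

lemma exp_coeff_step:
  "exp_coeff r (Suc n) - exp_coeff r n = exp_coeff (\<lambda>j. r j - 1) (Suc n)"
proof -
  have "Abs_fps (exp_coeff (\<lambda>j. r j - 1)) = Abs_fps (exp_coeff r) * (1 - fps_const 1 * fps_X)"
    using exp_coeff_add[of r "\<lambda>j. - (1 ^ Suc j)"] unfolding exp_coeff_linear by simp
  then have "fps_nth (Abs_fps (exp_coeff (\<lambda>j. r j - 1))) (Suc n)
      = fps_nth (Abs_fps (exp_coeff r) * (1 - fps_const 1 * fps_X)) (Suc n)"
    by (rule arg_cong)
  then show ?thesis
    by (simp add: algebra_simps)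
qed

text \<open>For \<open>\<beta> < \<alpha>\<close>, with \<open>b = \<beta> / \<alpha>\<close>, the generating functions satisfy
  \<open>(1 - z) G(z) = (1 - q\<^sup>b z) P(q\<^sup>b z)\<close> where the logarithmic derivative of \<open>P\<close> has nonincreasing
  coefficients \<open>K((j + 1) ln (1/q))\<close>, \<open>K\<close> as in \<open>levy_kernel_antimono\<close>.\<close>

lemma unimodal_seq_levy_coeff:
  assumes \<alpha>: "0 < \<alpha>" "\<alpha> \<le> 1" and \<beta>: "0 \<le> \<beta>" and q: "0 < q" "q < 1"
  shows "unimodal_seq (exp_coeff (levy_coeff \<alpha> \<beta> q))"
proof (cases "\<alpha> \<le> \<beta>")
  case True
  let ?p = "q powr (1 / \<alpha>)"
  note p = powr_frac_bounds[OF \<alpha> q]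
  \<comment> \<open>By \<open>exp_coeff_step\<close> these coefficients generate the increments.
    They are nonnegative because \<alpha> \<le> \<beta> gives
    \<open>q powr (\<beta> / \<alpha>) \<le> q\<close>.\<close>
  have "0 \<le> levy_coeff \<alpha> \<beta> q j - 1" for j
  proof -
    have pp: "?p ^ Suc j \<le> q ^ Suc j" "q ^ Suc j < 1"
      using p q power_Suc_less_one[of q j] by (auto intro!: power_mono simp del: power_Suc)
    have "q powr (\<beta> / \<alpha>) \<le> q"
      using powr_mono'[of 1 "\<beta> / \<alpha>" q] \<alpha> True q by simp
    then have "(q powr (\<beta> / \<alpha>)) ^ Suc j \<le> q ^ Suc j"
      by (intro power_mono) auto
    then have "(q powr (\<beta> / \<alpha>)) ^ Suc j / (1 - ?p ^ Suc j) \<le> q ^ Suc j / (1 - q ^ Suc j)"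
      using pp q by (intro frac_le) auto
    also have "\<dots> = 1 / (1 - q ^ Suc j) - 1"
      using pp by (simp add: field_simps del: power_Suc)
    finally show ?thesis
      by (simp add: levy_coeff_def)
  qed
  then have "0 \<le> exp_coeff (\<lambda>j. levy_coeff \<alpha> \<beta> q j - 1) n" for n
    by (rule exp_coeff_nonneg)
  then have "0 \<le> exp_coeff (levy_coeff \<alpha> \<beta> q) (Suc n) - exp_coeff (levy_coeff \<alpha> \<beta> q) n" for n
    unfolding exp_coeff_step .
  then show ?thesis
    unfolding unimodal_seq_def by simp
next
  case False
  define b where "b = \<beta> / \<alpha>"
  have b: "0 \<le> b" "b \<le> 1"
    using \<alpha> \<beta> False by (auto simp: b_def)
  let ?p = "q powr (1 / \<alpha>)"
  note p = powr_frac_bounds[OF \<alpha> q]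
  define d where "d = - ln q"
  have d: "0 < d"
    using q by (simp add: d_def)
  define K where "K = (\<lambda>x. exp (b * x) / (exp x - 1) - 1 / (exp (1 / \<alpha> * x) - 1))"
  define r where "r = (\<lambda>j. K (real (Suc j) * d))"
  have qpow: "(q powr e) ^ Suc j = exp (- (e * (real (Suc j) * d)))" for e j
    unfolding powr_mult_Suc[OF q(1), symmetric] using q by (simp add: d_def powr_def mult_ac)
  have r_dec: "r (Suc j) \<le> r j" for j
    unfolding r_def K_def using b \<alpha> d by (intro levy_kernel_antimono) auto
  have r_nn: "0 \<le> r j" for j
  proof -
    let ?x = "real (Suc j) * d"
    have x: "0 < ?x"
      using d by simp
    have "?x \<le> 1 / \<alpha> * ?x"
      using mult_right_mono[of 1 "1 / \<alpha>" ?x] x \<alpha> by simp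
    then have "1 / (exp (1 / \<alpha> * ?x) - 1) \<le> exp (b * ?x) / (exp ?x - 1)"
      using x b by (intro frac_le) auto
    then show ?thesis
      by (simp add: r_def K_def)
  qed
  define s where "s = q powr b"
  have s: "0 < s"
    using q by (simp add: s_def)
  \<comment> \<open>In 1/(1 - 1/X) = 1 + 1/(X - 1) the constant cancels against the subtracted 1; in
    the corresponding expression for Y it survives with weight 1/B and yields the factor 1 - s z.
    Its scale \<open>s\<close> agrees with that of the other factor, so a common power of
    \<open>s\<close> comes out of the increments.\<close>
  have coeff: "levy_coeff \<alpha> \<beta> q j - 1 = s ^ Suc j * r j + - (s ^ Suc j)" for j
  proof -
    define x where "x = real (Suc j) * d"
    have x: "0 < x" "0 < 1 / \<alpha> * x"
      using d \<alpha> by (auto simp: x_def)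
    define X where "X = exp x"
    define Y where "Y = exp (1 / \<alpha> * x)"
    define B where "B = exp (b * x)"
    have XY: "1 < X" "1 < Y" "0 < B"
      using x by (auto simp: X_def Y_def B_def)
    have e: "q ^ Suc j = 1 / X" "?p ^ Suc j = 1 / Y" "s ^ Suc j = 1 / B"
      using qpow[of 1 j] qpow[of "1 / \<alpha>" j] qpow[of b j] q
      by (simp_all add: s_def x_def X_def Y_def B_def exp_minus inverse_eq_divide del: of_nat_Suc power_Suc)
    have rj: "r j = B / (X - 1) - 1 / (Y - 1)"
      by (simp add: r_def K_def x_def X_def Y_def B_def)
    have "levy_coeff \<alpha> \<beta> q j = 1 / (1 - 1 / X) - (1 / B) / (1 - 1 / Y)"
      unfolding levy_coeff_def b_def[symmetric] s_def[symmetric] e ..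
    also have "1 / (1 - 1 / X) = 1 + 1 / (X - 1)"
      using XY by (simp add: divide_simps)
    also have "(1 / B) / (1 - 1 / Y) = 1 / B * (1 + 1 / (Y - 1))"
      using XY by (simp add: divide_simps)
    finally show ?thesis
      unfolding e rj using XY by (simp add: algebra_simps)
  qed
  have diff: "exp_coeff (levy_coeff \<alpha> \<beta> q) (Suc n) - exp_coeff (levy_coeff \<alpha> \<beta> q) n
     = s ^ Suc n * (exp_coeff r (Suc n) - exp_coeff r n)" for n
  proof -
    have "Abs_fps (exp_coeff (\<lambda>j. levy_coeff \<alpha> \<beta> q j - 1))
        = Abs_fps (exp_coeff (\<lambda>j. s ^ Suc j * r j)) * (1 - fps_const s * fps_X)"
      using exp_coeff_add[of "\<lambda>j. s ^ Suc j * r j" "\<lambda>j. - (s ^ Suc j)"]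
      unfolding exp_coeff_linear coeff by (rule sym)
    then have "exp_coeff (\<lambda>j. levy_coeff \<alpha> \<beta> q j - 1) (Suc n)
        = fps_nth (Abs_fps (exp_coeff (\<lambda>j. s ^ Suc j * r j)) * (1 - fps_const s * fps_X)) (Suc n)"
      by (metis fps_nth_Abs_fps)
    also have "\<dots> = s ^ Suc n * (exp_coeff r (Suc n) - exp_coeff r n)"
      unfolding exp_coeff_scale by (simp add: algebra_simps exp_coeff_scale del: power_Suc) (simp add: algebra_simps)
    finally show ?thesis
      by (simp add: exp_coeff_step)
  qed
  have "unimodal_seq (exp_coeff r)"
    using r_dec r_nn by (rule unimodal_seq_exp_coeff)
  then show ?thesis
    by (rule unimodal_seq_transfer[of _ "\<lambda>n. s ^ Suc n"]) (use s diff in auto)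
qed

text \<open>With p = q^(1/\<alpha>), the numerator factor q^((i+\<beta>)/\<alpha>) z at z = q^(k+1)
  equals p^(\<alpha>(k+1)+\<beta>+i). This is the origin of the second base.\<close>

lemma levy_coeff_sums:
  assumes \<alpha>: "0 < \<alpha>" "\<alpha> \<le> 1" and \<beta>: "0 \<le> \<beta>" and q: "0 < q" "q < 1"
  shows "(\<lambda>n. exp_coeff (levy_coeff \<alpha> \<beta> q) n * (q ^ Suc k) ^ n)
    sums exp (log_qpoch q (real (Suc k)) - log_qpoch (q powr (1 / \<alpha>)) (\<alpha> * real (Suc k) + \<beta>))"
proof -
  let ?p = "q powr (1 / \<alpha>)" and ?y = "\<alpha> * real (Suc k) + \<beta>"
  note p = powr_frac_bounds[OF \<alpha> q]
  have y: "0 < ?y"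
    using \<alpha> \<beta> by (intro add_pos_nonneg) auto
  have zlt: "q ^ Suc k < 1"
    using q power_Suc_less_one[of q k] by simp
  have eq: "levy_coeff \<alpha> \<beta> q j * (q ^ Suc k) ^ Suc j / real (Suc j)
     = q powr (real (Suc k) * real (Suc j)) / (real (Suc j) * (1 - q ^ Suc j))
       - ?p powr (?y * real (Suc j)) / (real (Suc j) * (1 - ?p ^ Suc j))" for j
  proof -
    have "q powr (real (Suc k) * real (Suc j)) = (q ^ Suc k) ^ Suc j"
      using powr_mult_Suc[OF q(1), of "real (Suc k)" j] powr_realpow[OF q(1), of "Suc k"] by simp
    moreover have "?p powr (?y * real (Suc j)) = (q powr (\<beta> / \<alpha>)) ^ Suc j * (q ^ Suc k) ^ Suc j"
    proof -
      have "?p powr (?y * real (Suc j)) = (q powr (1 / \<alpha> * ?y)) ^ Suc j"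
        using powr_mult_Suc[OF p(1), of ?y j] by (simp add: powr_powr)
      also have "1 / \<alpha> * ?y = \<beta> / \<alpha> + real (Suc k)"
        using \<alpha> by (simp add: field_simps)
      also have "q powr (\<beta> / \<alpha> + real (Suc k)) = q powr (\<beta> / \<alpha>) * q ^ Suc k"
        using q by (simp only: powr_add powr_realpow)
      finally show ?thesis
        by (simp only: power_mult_distrib)
    qed
    moreover have "(1 / X - B / Y) * A / m = A / (m * X) - B * A / (m * Y)" for A B X Y m :: real
      by (simp add: algebra_simps diff_divide_distrib)
    ultimately show ?thesis
      by (simp only: levy_coeff_def)
  qed
  have "(\<Sum>j. levy_coeff \<alpha> \<beta> q j * (q ^ Suc k) ^ Suc j / real (Suc j))
      = log_qpoch q (real (Suc k)) - log_qpoch ?p ?y"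
    unfolding eq log_qpoch_def
    by (intro suminf_diff[symmetric] summable_log_qpoch q p y) simp
  then show ?thesis
    using exp_coeff_sums[of "levy_coeff \<alpha> \<beta> q" "1 / (1 - q)" "q ^ Suc k"]
      levy_coeff_bounds[OF \<alpha> \<beta> q] q zlt by simp
qed

section \<open>Step functions on geometric grids\<close>

text \<open>The floor recovers the index n of the cell with c q^(n+1) < x \<le> c q^n. Larger
  indices lie closer to 0, so \<open>g\<close> and the density vary in opposite directions.\<close>

definition step_density :: "(nat \<Rightarrow> real) \<Rightarrow> real \<Rightarrow> real \<Rightarrow> real \<Rightarrow> real" where
  "step_density g q c x = (if 0 < x \<and> x \<le> c then g (nat \<lfloor>ln (x / c) / ln q\<rfloor>) else 0)"

lemma step_density_eq:
  assumes q: "0 < q" "q < 1" and c: "0 < c" and x: "c * q ^ Suc n < x" "x \<le> c * q ^ n"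
  shows "step_density g q c x = g n"
proof -
  have x0: "0 < x"
    using c q x(1) by (smt (verit) mult_pos_pos zero_less_power)
  have "c * q ^ n \<le> c * 1"
    using c q by (intro mult_left_mono power_le_one) auto
  with x have "x \<le> c" by simp
  have "q ^ Suc n < x / c" "x / c \<le> q ^ n"
    using x c by (simp_all add: field_simps)
  then have "ln (q ^ Suc n) < ln (x / c)" "ln (x / c) \<le> ln (q ^ n)"
    using q x0 c by (simp_all only: ln_less_cancel_iff ln_le_cancel_iff zero_less_power divide_pos_pos)
  then have "real (Suc n) * ln q < ln (x / c)" "ln (x / c) \<le> real n * ln q"
    using q by (simp_all add: ln_realpow del: power_Suc)
  then have "ln (x / c) / ln q < real (Suc n)" "real n \<le> ln (x / c) / ln q"
    using q by (simp_all add: field_simps)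
  then have "\<lfloor>ln (x / c) / ln q\<rfloor> = int n"
    by (intro floor_unique) auto
  then show ?thesis
    using x0 \<open>x \<le> c\<close> by (simp add: step_density_def)
qed

lemma step_density_cell:
  fixes c q x :: real
  assumes q: "0 < q" "q < 1" and c: "0 < c" and x: "0 < x" "x \<le> c"
  obtains n where "c * q ^ Suc n < x" "x \<le> c * q ^ n"
proof -
  have "\<exists>n. q ^ n < x / c"
    using real_arch_pow_inv[of "x / c" q] q c x by simp
  then obtain k where "q ^ k < x / c" "\<And>n. n < k \<Longrightarrow> \<not> q ^ n < x / c"
    using exists_least_iff[of "\<lambda>n. q ^ n < x / c"] by blast
  moreover from this x c have "k \<noteq> 0"
    by (intro notI) (simp add: field_simps)
  then obtain n where "k = Suc n"
    by (cases k) auto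
  ultimately have "q ^ Suc n < x / c" "\<not> q ^ n < x / c"
    by auto
  then show thesis
    using c by (intro that[of n]) (auto simp: field_simps)
qed

lemma step_cell_le:
  fixes c q :: real
  assumes "0 < q" "q < 1" "0 < c" and "c * q ^ Suc i < c * q ^ j"
  shows "j \<le> i"
proof -
  have "q ^ Suc i < q ^ j"
    using assms by simp
  then have "j < Suc i"
    using assms by (simp only: power_strict_decreasing_iff)
  then show ?thesis by simp
qed

lemma step_density_antimono:
  assumes q: "0 < q" "q < 1" and c: "0 < c" and g: "\<And>n. 0 \<le> g n"
    and mono: "\<And>i j. i \<le> j \<Longrightarrow> c * q ^ j > a \<Longrightarrow> g i \<le> g j" and x: "0 < x" "a < x" "x \<le> y"
  shows "step_density g q c y \<le> step_density g q c x"
proof (cases "y \<le> c")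
  case False
  then show ?thesis
    using g by (simp add: step_density_def)
next
  case True
  obtain i where i: "c * q ^ Suc i < x" "x \<le> c * q ^ i"
    using step_density_cell[OF q c, of x] x True by auto
  obtain j where j: "c * q ^ Suc j < y" "y \<le> c * q ^ j"
    using step_density_cell[OF q c, of y] x True by auto
  have "j \<le> i"
    using i j x by (intro step_cell_le[OF q c]) linarith
  then have "g j \<le> g i"
    using i x by (intro mono) auto
  then show ?thesis
    using step_density_eq[OF q c i] step_density_eq[OF q c j] by simp
qed

lemma step_density_mono:
  assumes q: "0 < q" "q < 1" and c: "0 < c" and g: "\<And>n. 0 \<le> g n"
    and anti: "\<And>i j. m \<le> i \<Longrightarrow> i \<le> j \<Longrightarrow> g j \<le> g i" and x: "x \<le> y" "y < c * q ^ m"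
  shows "step_density g q c x \<le> step_density g q c y"
proof (cases "0 < x")
  case False
  then show ?thesis
    using g by (simp add: step_density_def)
next
  case True
  have "c * q ^ m \<le> c * 1"
    using c q by (intro mult_left_mono power_le_one) auto
  then have yc: "y \<le> c"
    using x by simp
  obtain i where i: "c * q ^ Suc i < x" "x \<le> c * q ^ i"
    using step_density_cell[OF q c, of x] x True yc by auto
  obtain j where j: "c * q ^ Suc j < y" "y \<le> c * q ^ j"
    using step_density_cell[OF q c, of y] x True yc by auto
  have "c * q ^ Suc i < c * q ^ j" "c * q ^ Suc j < c * q ^ m"
    using i j x by linarith+
  then have "j \<le> i" "m \<le> j"
    by (auto intro: step_cell_le[OF q c])
  then have "g i \<le> g j"
    by (intro anti)
  then show ?thesis
    using step_density_eq[OF q c i] step_density_eq[OF q c j] by simp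
qed

text \<open>A mode at index m becomes the right endpoint c q^m of its cell. A sequence that
  increases forever has its mode at infinity, which corresponds to the point 0.\<close>

lemma step_density_unimodal:
  assumes q: "0 < q" "q < 1" and c: "0 < c" and g: "\<And>n. 0 \<le> g n" and uni: "unimodal_seq g"
  shows "\<exists>m\<ge>0. (\<forall>x y. x \<le> y \<longrightarrow> y < m \<longrightarrow> step_density g q c x \<le> step_density g q c y) \<and>
    (\<forall>x y. m < x \<longrightarrow> x \<le> y \<longrightarrow> step_density g q c y \<le> step_density g q c x)"
  using uni
proof (cases rule: unimodal_seqE)
  case 1
  have "step_density g q c x \<le> step_density g q c y" if "x \<le> y" "y < 0" for x y
    using that by (simp add: step_density_def)
  moreover have "step_density g q c y \<le> step_density g q c x" if "0 < x" "x \<le> y" for x y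
    using that 1 by (intro step_density_antimono[OF q c g, where a = 0]) (auto simp: incseq_def)
  ultimately show ?thesis by blast
next
  case (2 m)
  have "0 \<le> c * q ^ m"
    using c q by simp
  moreover have "step_density g q c x \<le> step_density g q c y" if "x \<le> y" "y < c * q ^ m" for x y
    using that 2(2) by (intro step_density_mono[OF q c g, where m = m]) auto
  moreover have "step_density g q c y \<le> step_density g q c x" if x: "c * q ^ m < x" "x \<le> y" for x y
  proof (rule step_density_antimono[OF q c g, where a = "c * q ^ m"])
    show "0 < x"
      using x \<open>0 \<le> c * q ^ m\<close> by simp
    show "g i \<le> g j" if "i \<le> j" "c * q ^ m < c * q ^ j" for i j
    proof (rule 2(1)[OF that(1)])
      have "q ^ m < q ^ j"
        using that c by simp
      then show "j \<le> m"
        using q by (simp add: power_strict_decreasing_iff less_imp_le)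
    qed
  qed (use x in auto)
  ultimately show ?thesis by blast
qed

lemma borel_measurable_step_density [measurable]: "step_density g q c \<in> borel_measurable borel"
  unfolding step_density_def[abs_def] by measurable

lemma nn_integral_power_Ioc:
  fixes a b :: real
  assumes "0 \<le> a" "a \<le> b"
  shows "(\<integral>\<^sup>+x. ennreal (x ^ k) * indicator {a<..b} x \<partial>lborel) = ennreal ((b ^ Suc k - a ^ Suc k) / real (Suc k))"
proof -
  have "(\<integral>\<^sup>+x. ennreal (x ^ k) * indicator {a<..b} x \<partial>lborel) = (\<integral>\<^sup>+x. ennreal (x ^ k) * indicator {a..b} x \<partial>lborel)"
    using AE_lborel_singleton[of a]
    by (intro nn_integral_cong_AE) (auto elim!: eventually_mono split: split_indicator)
  also have "\<dots> = ennreal (b ^ Suc k / real (Suc k) - a ^ Suc k / real (Suc k))"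
    using assms
    by (intro nn_integral_FTC_Icc)
       (auto intro!: derivative_eq_intros simp del: of_nat_Suc power_Suc)
  finally show ?thesis
    by (simp only: diff_divide_distrib)
qed

text \<open>The integral of x^k over cell n is a constant times q^((k+1)n), so summing over the
  cells evaluates the generating function of \<open>g\<close> at q^(k+1). An arithmetic grid would
  not do this.\<close>

lemma nn_integral_step_density:
  assumes q: "0 < q" "q < 1" and c: "0 < c" and g: "\<And>n. 0 \<le> g n"
    and sums: "(\<lambda>n. g n * (q ^ Suc k) ^ n) sums G"
  shows "(\<integral>\<^sup>+x. ennreal (step_density g q c x * x ^ k) \<partial>lborel)
    = ennreal (c ^ Suc k * (1 - q ^ Suc k) / real (Suc k) * G)"
proof -
  let ?I = "\<lambda>n. {c * q ^ Suc n<..c * q ^ n}"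
  have pw: "ennreal (step_density g q c x * x ^ k) = (\<Sum>n. ennreal (g n) * (ennreal (x ^ k) * indicator (?I n) x))" for x
  proof (cases "0 < x \<and> x \<le> c")
    case True
    then obtain n where n: "c * q ^ Suc n < x" "x \<le> c * q ^ n"
      using step_density_cell[OF q c, of x] by auto
    have "x \<notin> ?I i" if "i \<noteq> n" for i
    proof
      assume "x \<in> ?I i"
      then have "c * q ^ Suc n < c * q ^ i" "c * q ^ Suc i < c * q ^ n"
        using n by auto
      then have "i = n"
        by (meson antisym step_cell_le[OF q c])
      with that show False by simp
    qed
    then have "(\<Sum>i. ennreal (g i) * (ennreal (x ^ k) * indicator (?I i) x))
        = (\<Sum>i\<in>{n}. ennreal (g i) * (ennreal (x ^ k) * indicator (?I i) x))"
      by (intro suminf_finite) auto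
    also have "\<dots> = ennreal (g n) * ennreal (x ^ k)"
      using n by simp
    finally show ?thesis
      using g True step_density_eq[OF q c n] by (simp add: ennreal_mult)
  next
    case False
    have "x \<notin> ?I n" for n
    proof -
      have "0 < c * q ^ Suc n"
        using q c by simp
      moreover have "c * q ^ n \<le> c * 1"
        using q c by (intro mult_left_mono power_le_one) auto
      ultimately show ?thesis
        using False by auto
    qed
    then have "(\<Sum>n. ennreal (g n) * (ennreal (x ^ k) * indicator (?I n) x)) = 0"
      by simp
    with False show ?thesis
      by (auto simp: step_density_def)
  qed
  have cell: "(\<integral>\<^sup>+x. ennreal (x ^ k) * indicator (?I n) x \<partial>lborel)
      = ennreal (c ^ Suc k * (1 - q ^ Suc k) / real (Suc k) * (q ^ Suc k) ^ n)" for n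
  proof -
    have "c * q ^ Suc n \<le> c * q ^ n"
      using q c by (intro mult_left_mono power_decreasing) auto
    moreover have "(q ^ n) ^ Suc k = (q ^ Suc k) ^ n" "(q ^ Suc n) ^ Suc k = (q ^ Suc k) ^ n * q ^ Suc k"
      by (simp_all only: power_mult[symmetric] power_add[symmetric]) (simp_all add: algebra_simps)
    ultimately show ?thesis
      using q c by (subst nn_integral_power_Ioc) (auto simp: power_mult_distrib algebra_simps simp del: power_Suc)
  qed
  have nn: "0 \<le> c ^ Suc k * (1 - q ^ Suc k) / real (Suc k)"
    using q c by (intro divide_nonneg_nonneg mult_nonneg_nonneg) (auto intro: power_le_one simp del: power_Suc)
  have "(\<integral>\<^sup>+x. ennreal (step_density g q c x * x ^ k) \<partial>lborel)
      = (\<Sum>n. ennreal (g n) * (\<integral>\<^sup>+x. ennreal (x ^ k) * indicator (?I n) x \<partial>lborel))"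
    unfolding pw by (simp add: nn_integral_suminf nn_integral_cmult)
  also have "\<dots> = (\<Sum>n. ennreal (c ^ Suc k * (1 - q ^ Suc k) / real (Suc k) * (g n * (q ^ Suc k) ^ n)))"
    unfolding cell using g by (intro suminf_cong) (simp add: ennreal_mult'[symmetric] mult_ac del: power_Suc of_nat_Suc)
  also have "\<dots> = ennreal (c ^ Suc k * (1 - q ^ Suc k) / real (Suc k) * G)"
    using sums_mult[OF sums, of "c ^ Suc k * (1 - q ^ Suc k) / real (Suc k)"] nn g q
    by (intro sums_unique[symmetric] sums_ennreal[THEN iffD2] mult_nonneg_nonneg)
       (auto intro!: mult_nonneg_nonneg sums_le[OF _ sums_zero sums] simp del: power_Suc of_nat_Suc)
  finally show ?thesis .
qed

section \<open>Approximation of the law\<close>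

text \<open>Vanishing is demanded for x < 0 and not at 0, where the exponential density equals 1.
  The condition \<open>v 0 = 1\<close> fixes the total mass.\<close>

definition unimodal_positive_density :: "(real \<Rightarrow> real) \<Rightarrow> (nat \<Rightarrow> real) \<Rightarrow> bool" where
  "unimodal_positive_density f v \<longleftrightarrow> f \<in> borel_measurable borel \<and> (\<forall>x. 0 \<le> f x) \<and> (\<forall>x<0. f x = 0) \<and>
     v 0 = 1 \<and> (\<forall>k. 0 \<le> v k) \<and> (\<forall>k. (\<integral>\<^sup>+x. ennreal (f x * x ^ k) \<partial>lborel) = ennreal (v k)) \<and>
     (\<exists>m\<ge>0. (\<forall>x y. x \<le> y \<longrightarrow> y < m \<longrightarrow> f x \<le> f y) \<and> (\<forall>x y. m < x \<longrightarrow> x \<le> y \<longrightarrow> f y \<le> f x))"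

lemma unimodal_positive_density_law:
  assumes "unimodal_positive_density f v"
  defines "D \<equiv> density lborel f"
  shows "real_distribution D"
    and "has_bochner_integral D (\<lambda>x. x ^ k) (v k)" and "has_bochner_integral D (\<lambda>x. \<bar>x\<bar> ^ k) (v k)"
    and "cdf D 0 = 0"
    and "\<exists>m\<ge>0. convex_on {..<m} (cdf D) \<and> concave_on {m<..} (cdf D)"
proof -
  have f: "f \<in> borel_measurable borel" "\<And>x. 0 \<le> f x" "\<And>x. x < 0 \<Longrightarrow> f x = 0"
    and v: "v 0 = 1" "\<And>k. 0 \<le> v k" "\<And>k. (\<integral>\<^sup>+x. ennreal (f x * x ^ k) \<partial>lborel) = ennreal (v k)"
    and uni: "\<exists>m\<ge>0. (\<forall>x y. x \<le> y \<longrightarrow> y < m \<longrightarrow> f x \<le> f y) \<and> (\<forall>x y. m < x \<longrightarrow> x \<le> y \<longrightarrow> f y \<le> f x)"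
    using assms(1) by (auto simp: unimodal_positive_density_def)
  note [measurable] = f(1)
  have "emeasure D (space D) = 1"
    using v(3)[of 0] by (simp add: D_def emeasure_density v(1))
  then have "prob_space D"
    by (rule prob_spaceI)
  then show D: "real_distribution D"
    by (simp add: real_distribution_def real_distribution_axioms_def D_def)
  interpret real_distribution D by (rule D)
  show abs: "has_bochner_integral D (\<lambda>x. \<bar>x\<bar> ^ k) (v k)"
  proof (rule has_bochner_integral_nn_integral)
    have "(\<integral>\<^sup>+x. ennreal (\<bar>x\<bar> ^ k) \<partial>D) = (\<integral>\<^sup>+x. ennreal (f x) * ennreal (\<bar>x\<bar> ^ k) \<partial>lborel)"
      unfolding D_def by (intro nn_integral_density) auto
    also have "\<dots> = (\<integral>\<^sup>+x. ennreal (f x * x ^ k) \<partial>lborel)"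
    proof (rule nn_integral_cong)
      fix x
      show "ennreal (f x) * ennreal (\<bar>x\<bar> ^ k) = ennreal (f x * x ^ k)"
        using f by (cases "x < 0") (auto simp: ennreal_mult)
    qed
    finally show "(\<integral>\<^sup>+x. ennreal (\<bar>x\<bar> ^ k) \<partial>D) = ennreal (v k)"
      by (simp add: v(3))
  qed (auto simp: v(2) D_def)
  have "AE x in D. x ^ k = \<bar>x\<bar> ^ k"
  proof -
    have "AE x in D. 0 \<le> x"
      unfolding D_def using f(3) by (subst AE_density) (auto simp: not_less[symmetric])
    then show ?thesis
      by eventually_elim simp
  qed
  then show "has_bochner_integral D (\<lambda>x. x ^ k) (v k)"
    using abs by (subst has_bochner_integral_cong_AE[where g = "\<lambda>x. \<bar>x\<bar> ^ k"]) (auto simp: D_def)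
  have "emeasure D {..0} = (\<integral>\<^sup>+x. ennreal (f x) * indicator {..0} x \<partial>lborel)"
    unfolding D_def by (subst emeasure_density) auto
  also have "\<dots> = (\<integral>\<^sup>+x. 0 \<partial>(lborel :: real measure))"
    using AE_lborel_singleton[of 0] f(3)
    by (intro nn_integral_cong_AE) (auto elim!: eventually_mono split: split_indicator)
  finally show "cdf D 0 = 0"
    by (simp add: cdf_def measure_def)
  obtain m where m: "0 \<le> m" "\<And>x y. x \<le> y \<Longrightarrow> y < m \<Longrightarrow> f x \<le> f y" "\<And>x y. m < x \<Longrightarrow> x \<le> y \<Longrightarrow> f y \<le> f x"
    using uni by blast
  have "convex_on {..<m} (cdf D)" "concave_on {m<..} (cdf D)"
    using unimodal_law_density[of f m, OF D[unfolded D_def] f(2) f(1) m(2) m(3)] by (simp_all add: D_def)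
  with m(1) show "\<exists>m\<ge>0. convex_on {..<m} (cdf D) \<and> concave_on {m<..} (cdf D)"
    by blast
qed

text \<open>The growth bound on the moments of \<open>X\<close> itself is inherited in the limit
  from the approximating moments; with it the method of moments applies to both sides.\<close>

lemma unimodal_if_moments_limit:
  assumes X: "is_M_variable \<alpha> \<beta> M X" and \<alpha>: "0 \<le> \<alpha>"
    and f: "\<And>N. unimodal_positive_density (f N) (v N)"
    and bd: "\<And>N k. v N k \<le> fact k * R ^ k" and R: "0 < R"
    and lim: "\<And>k. (\<lambda>N. v N k) \<longlonglongrightarrow> gen_pochhammer 1 (real k) / gen_pochhammer (\<alpha> + \<beta>) (\<alpha> * real k)"
  shows "unimodal M X"
proof -
  interpret prob_space M
    using X by (simp add: is_M_variable_def)
  have X_meas [measurable]: "X \<in> borel_measurable M" and X_pos: "AE \<omega> in M. 0 < X \<omega>"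
    using X by (auto simp: is_M_variable_def)
  let ?L = "distr M borel X" and ?D = "\<lambda>N. density lborel (f N)"
  define w where "w = (\<lambda>k. gen_pochhammer 1 (real k) / gen_pochhammer (\<alpha> + \<beta>) (\<alpha> * real k))"
  have L: "real_distribution ?L"
    by simp
  have X_moment: "has_bochner_integral M (\<lambda>\<omega>. X \<omega> powr real k) (w k)" for k
    using X unfolding is_M_variable_def w_def by (metis of_nat_0_le_iff order_less_le_trans neg_less_0_iff_less zero_less_one)
  have "has_bochner_integral M (\<lambda>\<omega>. X \<omega> ^ k) (w k)" for k
    using X_moment[of k] X_pos
    by (subst has_bochner_integral_cong_AE[where g = "\<lambda>\<omega>. X \<omega> powr real k"])
       (auto elim!: eventually_mono simp: powr_realpow)
  then have L_moment: "has_bochner_integral ?L (\<lambda>x. x ^ k) (w k)" for k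
    by (simp add: has_bochner_integral_distr)
  have "has_bochner_integral M (\<lambda>\<omega>. \<bar>X \<omega>\<bar> ^ k) (w k)" for k
    using X_moment[of k] X_pos
    by (subst has_bochner_integral_cong_AE[where g = "\<lambda>\<omega>. X \<omega> powr real k"])
       (auto elim!: eventually_mono simp: powr_realpow)
  then have L_abs: "has_bochner_integral ?L (\<lambda>x. \<bar>x\<bar> ^ k) (w k)" for k
    by (simp add: has_bochner_integral_distr)
  have w_le: "w k \<le> fact k * R ^ k" for k
    using lim[of k] bd by (intro LIMSEQ_le_const2[of "\<lambda>N. v N k"]) (auto simp: w_def)
  note law = unimodal_positive_density_law[OF f]
  have conv: "weak_conv_m ?D ?L"
  proof (rule method_of_moments[where R = R])
    show "integrable (?D N) (\<lambda>x. x ^ k)" "(\<integral>x. \<bar>x\<bar> ^ k \<partial>?D N) \<le> fact k * R ^ k" for N k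
      using law(2,3)[of N k] bd[of N k] by (auto simp: has_bochner_integral_iff)
    show "integrable ?L (\<lambda>x. x ^ k)" "(\<integral>x. \<bar>x\<bar> ^ k \<partial>?L) \<le> fact k * R ^ k" for k
      using L_moment[of k] L_abs[of k] w_le[of k] by (auto simp: has_bochner_integral_iff)
    show "(\<lambda>N. \<integral>x. x ^ k \<partial>?D N) \<longlonglongrightarrow> (\<integral>x. x ^ k \<partial>?L)" for k
      using lim[of k] law(2) L_moment[of k] by (simp add: has_bochner_integral_iff w_def)
  qed (use law(1) L R in auto)
  obtain m where m: "\<And>N. 0 \<le> m N" "\<And>N. convex_on {..<m N} (cdf (?D N))" "\<And>N. concave_on {m N<..} (cdf (?D N))"
    using law(5) by metis
  have "unimodal_law ?L"
    by (rule unimodal_law_weak_limit[OF law(1) L conv m(1) law(4) m(2,3)])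
  then show ?thesis
    by (simp add: unimodal_def)
qed

lemma unimodal_exponential_density: "unimodal_positive_density (exponential_density 1) fact"
  unfolding unimodal_positive_density_def
proof (intro conjI allI impI exI[of _ "0::real"])
  show "(\<integral>\<^sup>+x. ennreal (exponential_density 1 x * x ^ k) \<partial>lborel) = ennreal (fact k)" for k
    using nn_integral_erlang_ith_moment[of 1 0 k] by simp
qed (auto simp: erlang_density_def)

text \<open>The q-analogue of \<open>k! \<Gamma>(\<alpha> + \<beta>) / \<Gamma>(\<alpha> + \<beta> + \<alpha> k)\<close>.\<close>

definition step_moment :: "real \<Rightarrow> real \<Rightarrow> real \<Rightarrow> nat \<Rightarrow> real" where
  "step_moment \<alpha> \<beta> q k = (1 - q powr real (Suc k)) / (1 - q) / real (Suc k) *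
     (\<Prod>i<k. (1 - q powr (1 + real i)) / (1 - q) * qgamma_ratio (q powr (1 / \<alpha>)) (\<alpha> + \<beta> + \<alpha> * real i) \<alpha>)"

text \<open>The Gamma quotient over the increment \<open>t * real k\<close> is cut into k
  telescoping steps of length \<open>t\<close>, since the limit and the bound for
  \<open>qgamma_ratio\<close> hold for steps of length at most 1; here t is \<alpha>.\<close>

lemma prod_qgamma_ratio:
  assumes "0 < p" "p < 1"
  shows "(\<Prod>i<k. qgamma_ratio p (x + t * real i) t) = ((1 - p) powr t) ^ k * exp (log_qpoch p x - log_qpoch p (x + t * real k))"
proof (induction k)
  case (Suc k)
  have "x + t * real k + t = x + t * real (Suc k)"
    by (simp add: algebra_simps)
  then have "qgamma_ratio p (x + t * real k) t = (1 - p) powr t * exp (log_qpoch p (x + t * real k) - log_qpoch p (x + t * real (Suc k)))"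
    by (simp only: qgamma_ratio_def)
  then have "(\<Prod>i<Suc k. qgamma_ratio p (x + t * real i) t)
      = ((1 - p) powr t) ^ Suc k * (exp (log_qpoch p x - log_qpoch p (x + t * real k)) *
         exp (log_qpoch p (x + t * real k) - log_qpoch p (x + t * real (Suc k))))"
    by (simp only: prod.lessThan_Suc Suc power_Suc mult_ac)
  then show ?case
    by (simp only: exp_add[symmetric]) simp
qed simp

lemma unimodal_step_density:
  assumes \<alpha>: "0 < \<alpha>" "\<alpha> \<le> 1" and \<beta>: "0 \<le> \<beta>" and q: "0 < q" "q < 1"
  shows "\<exists>f. unimodal_positive_density f (step_moment \<alpha> \<beta> q)"
proof -
  let ?p = "q powr (1 / \<alpha>)"
  note p = powr_frac_bounds[OF \<alpha> q]
  define g where "g = exp_coeff (levy_coeff \<alpha> \<beta> q)"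
  \<comment> \<open>The scale at which c^k supplies the normalising powers of 1 - q and 1 - p of the
    two q-Gamma functions; \<open>Z\<close> below is the total mass.\<close>
  define c where "c = (1 - ?p) powr \<alpha> / (1 - q)"
  define G where "G = (\<lambda>k. exp (log_qpoch q (real (Suc k)) - log_qpoch ?p (\<alpha> * real (Suc k) + \<beta>)))"
  define Z where "Z = c * (1 - q) * G 0"
  have c: "0 < c"
  proof -
    have "0 < 1 - ?p" "0 < 1 - q"
      using p(3) q by linarith+
    then show ?thesis
      by (simp add: c_def)
  qed
  have g: "0 \<le> g n" for n
    unfolding g_def using levy_coeff_bounds(1)[OF \<alpha> \<beta> q] by (rule exp_coeff_nonneg)
  have Z: "0 < Z"
    using c q by (simp add: Z_def G_def)
  have nn: "(\<integral>\<^sup>+x. ennreal (step_density g q c x * x ^ k) \<partial>lborel)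
      = ennreal (c ^ Suc k * (1 - q ^ Suc k) / real (Suc k) * G k)" for k
    unfolding G_def g_def
    by (rule nn_integral_step_density[OF q c g[unfolded g_def] levy_coeff_sums[OF \<alpha> \<beta> q]])
  have moment: "c ^ Suc k * (1 - q ^ Suc k) / real (Suc k) * G k / Z = step_moment \<alpha> \<beta> q k" for k
  proof -
    let ?x = "\<alpha> + \<beta>"
    have qk: "q ^ Suc k = q powr real (Suc k)"
      using q by (simp only: powr_realpow)
    have G: "G k / G 0 = (\<Prod>i<k. 1 - q powr (1 + real i)) * exp (log_qpoch ?p ?x - log_qpoch ?p (?x + \<alpha> * real k))"
    proof -
      have "G k / G 0 = exp (log_qpoch q (1 + real k) - log_qpoch q 1) * exp (log_qpoch ?p ?x - log_qpoch ?p (?x + \<alpha> * real k))"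
        unfolding G_def by (simp add: algebra_simps flip: exp_add exp_diff)
      then show ?thesis
        using log_qpoch_plus_nat[OF q, of 1 k] by simp
    qed
    have "c ^ k = ((1 - ?p) powr \<alpha>) ^ k * (\<Prod>i<k. 1 / (1 - q))"
      by (simp add: c_def power_divide)
    then have "c ^ k * (G k / G 0) = (\<Prod>i<k. 1 / (1 - q)) * (\<Prod>i<k. 1 - q powr (1 + real i))
        * (\<Prod>i<k. qgamma_ratio ?p (?x + \<alpha> * real i) \<alpha>)"
      unfolding G prod_qgamma_ratio[OF p(1,3)] by simp
    also have "\<dots> = (\<Prod>i<k. (1 - q powr (1 + real i)) / (1 - q) * qgamma_ratio ?p (?x + \<alpha> * real i) \<alpha>)"
      unfolding prod.distrib[symmetric] by (intro prod.cong) simp_all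
    \<comment> \<open>The leading factor stems from the width of the cells and tends to 1 with
      q.\<close>
    finally have "step_moment \<alpha> \<beta> q k = (1 - q ^ Suc k) / (1 - q) / real (Suc k) * (c ^ k * (G k / G 0))"
      unfolding step_moment_def qk by simp
    moreover have "c ^ Suc k * A / B * D / (c * C * E) = A / C / B * (c ^ k * (D / E))" for A B C D E :: real
      using c by (simp add: mult_ac)
    ultimately show ?thesis
      unfolding Z_def by simp
  qed
  have "unimodal_positive_density (\<lambda>x. step_density g q c x / Z) (step_moment \<alpha> \<beta> q)"
    unfolding unimodal_positive_density_def
  proof (intro conjI allI impI)
    have sd: "0 \<le> step_density g q c x" for x
      using g by (simp add: step_density_def)
    show "0 \<le> step_density g q c x / Z" for x
      using sd Z by simp
    show "step_density g q c x / Z = 0" if "x < 0" for x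
      using that by (simp add: step_density_def)
    show "step_moment \<alpha> \<beta> q 0 = 1"
      using q by (simp add: step_moment_def)
    show "0 \<le> step_moment \<alpha> \<beta> q k" for k
      unfolding moment[symmetric] using c q Z
      by (intro divide_nonneg_pos mult_nonneg_nonneg) (auto simp: G_def power_le_one simp del: power_Suc)
    show "(\<integral>\<^sup>+x. ennreal (step_density g q c x / Z * x ^ k) \<partial>lborel) = ennreal (step_moment \<alpha> \<beta> q k)" for k
    proof -
      have "(\<integral>\<^sup>+x. ennreal (step_density g q c x / Z * x ^ k) \<partial>lborel)
          = (\<integral>\<^sup>+x. ennreal (1 / Z) * ennreal (step_density g q c x * x ^ k) \<partial>lborel)"
        using Z by (intro nn_integral_cong) (simp add: ennreal_mult'[symmetric])
      also have "\<dots> = ennreal (1 / Z) * ennreal (c ^ Suc k * (1 - q ^ Suc k) / real (Suc k) * G k)"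
        by (subst nn_integral_cmult) (simp_all add: nn del: power_Suc of_nat_Suc)
      also have "\<dots> = ennreal (step_moment \<alpha> \<beta> q k)"
        unfolding moment[symmetric] using Z by (simp add: ennreal_mult'[symmetric] mult_ac del: power_Suc of_nat_Suc)
      finally show ?thesis .
    qed
    obtain m where m: "0 \<le> m" "\<And>x y. x \<le> y \<Longrightarrow> y < m \<Longrightarrow> step_density g q c x \<le> step_density g q c y"
        "\<And>x y. m < x \<Longrightarrow> x \<le> y \<Longrightarrow> step_density g q c y \<le> step_density g q c x"
      using step_density_unimodal[where g = g, OF q c g] unimodal_seq_levy_coeff[OF \<alpha> \<beta> q]
      unfolding g_def by blast
    show "\<exists>m\<ge>0. (\<forall>x y. x \<le> y \<longrightarrow> y < m \<longrightarrow> step_density g q c x / Z \<le> step_density g q c y / Z) \<and>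
      (\<forall>x y. m < x \<longrightarrow> x \<le> y \<longrightarrow> step_density g q c y / Z \<le> step_density g q c x / Z)"
      using m Z by (intro exI[of _ m]) (auto intro!: divide_right_mono)
  qed measurable
  then show ?thesis
    by (rule exI[where x = "\<lambda>x. step_density g q c x / Z"])
qed

section \<open>Growth and limit of the approximating moments\<close>

lemma step_moment_le:
  assumes \<alpha>: "0 < \<alpha>" "\<alpha> \<le> 1" and \<beta>: "0 \<le> \<beta>" and q: "0 < q" "q < 1"
  shows "step_moment \<alpha> \<beta> q k \<le> fact k * (2 / \<alpha>) ^ k"
proof -
  let ?p = "q powr (1 / \<alpha>)"
  note p = powr_frac_bounds[OF \<alpha> q]
  have qn: "0 \<le> (1 - q powr real (Suc i)) / (1 - q)" "(1 - q powr real (Suc i)) / (1 - q) \<le> real (Suc i)" for i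
  proof -
    have "(1 - q powr real (Suc i)) / (1 - q) = (1 - q ^ Suc i) / (1 - q)"
      using q by (simp only: powr_realpow)
    also have "\<dots> = (\<Sum>j<Suc i. q ^ j)"
      using q one_diff_power_eq[of q "Suc i"] by simp
    finally have eq: "(1 - q powr real (Suc i)) / (1 - q) = (\<Sum>j<Suc i. q ^ j)" .
    show "0 \<le> (1 - q powr real (Suc i)) / (1 - q)"
      unfolding eq using q by (intro sum_nonneg) auto
    have "(\<Sum>j<Suc i. q ^ j) \<le> (\<Sum>j<Suc i. 1)"
      using q by (intro sum_mono power_le_one) auto
    then show "(1 - q powr real (Suc i)) / (1 - q) \<le> real (Suc i)"
      unfolding eq by simp
  qed
  have "step_moment \<alpha> \<beta> q k \<le> 1 * (\<Prod>i<k. real (Suc i) * (2 / \<alpha>))"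
    unfolding step_moment_def
  proof (rule mult_mono)
    show "(1 - q powr real (Suc k)) / (1 - q) / real (Suc k) \<le> 1"
      using qn(2)[of k] by (subst divide_le_eq_1_pos) simp_all
    show "(\<Prod>i<k. (1 - q powr (1 + real i)) / (1 - q) * qgamma_ratio ?p (\<alpha> + \<beta> + \<alpha> * real i) \<alpha>)
        \<le> (\<Prod>i<k. real (Suc i) * (2 / \<alpha>))"
    proof (rule prod_mono, rule conjI)
      fix i
      show "0 \<le> (1 - q powr (1 + real i)) / (1 - q) * qgamma_ratio ?p (\<alpha> + \<beta> + \<alpha> * real i) \<alpha>"
        using qn(1)[of i] qgamma_ratio_nonneg by (intro mult_nonneg_nonneg) auto
      have "qgamma_ratio ?p (\<alpha> + \<beta> + \<alpha> * real i) \<alpha> \<le> 2 / \<alpha>"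
        using \<alpha> \<beta> by (intro qgamma_ratio_le p) auto
      then show "(1 - q powr (1 + real i)) / (1 - q) * qgamma_ratio ?p (\<alpha> + \<beta> + \<alpha> * real i) \<alpha> \<le> real (Suc i) * (2 / \<alpha>)"
        using qn[of i] qgamma_ratio_nonneg by (intro mult_mono) auto
    qed
    show "0 \<le> (\<Prod>i<k. (1 - q powr (1 + real i)) / (1 - q) * qgamma_ratio ?p (\<alpha> + \<beta> + \<alpha> * real i) \<alpha>)"
      using qn(1) qgamma_ratio_nonneg by (intro prod_nonneg mult_nonneg_nonneg) auto
  qed simp
  also have "\<dots> = fact k * (2 / \<alpha>) ^ k"
    unfolding prod.distrib by (simp add: fact_prod_Suc atLeast0LessThan)
  finally show ?thesis .
qed

lemma filterlim_powr_at_left_1: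
  fixes a :: real
  assumes "0 < a"
  shows "filterlim (\<lambda>q. q powr a) (at_left 1) (at_left 1)"
  unfolding filterlim_at
proof
  show "\<forall>\<^sub>F q in at_left 1. q powr a \<in> {..<1} \<and> q powr a \<noteq> 1"
    using eventually_at_left_real[of 0 "1::real"] by (rule eventually_mono) (use powr_less_one' assms in force)+
  have "((\<lambda>q. q powr a) \<longlongrightarrow> 1 powr a) (at_left 1)"
    by (intro tendsto_powr tendsto_ident_at tendsto_const) simp
  then show "((\<lambda>q. q powr a) \<longlongrightarrow> 1) (at_left 1)"
    by simp
qed

lemma step_moment_tendsto:
  assumes \<alpha>: "0 < \<alpha>" "\<alpha> \<le> 1" and \<beta>: "0 \<le> \<beta>"
  shows "((\<lambda>q. step_moment \<alpha> \<beta> q k) \<longlongrightarrow> gen_pochhammer 1 (real k) / gen_pochhammer (\<alpha> + \<beta>) (\<alpha> * real k)) (at_left 1)"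
proof -
  let ?x = "\<lambda>i. \<alpha> + \<beta> + \<alpha> * real i"
  have x: "0 < ?x i" for i
    using \<alpha> \<beta> by (simp add: add_pos_nonneg)
  have "((\<lambda>q. qgamma_ratio (q powr (1 / \<alpha>)) (?x i) \<alpha>) \<longlongrightarrow> Gamma (?x i) / Gamma (?x i + \<alpha>)) (at_left 1)" for i
    by (rule filterlim_compose[OF qgamma_ratio_tendsto filterlim_powr_at_left_1]) (use \<alpha> x[of i] in auto)
  then have "((\<lambda>q. step_moment \<alpha> \<beta> q k) \<longlongrightarrow> real (Suc k) / real (Suc k) *
      (\<Prod>i<k. (1 + real i) * (Gamma (?x i) / Gamma (?x i + \<alpha>)))) (at_left 1)"
    unfolding step_moment_def by (intro tendsto_intros tendsto_q_number) auto
  also have "(\<Prod>i<k. (1 + real i) * (Gamma (?x i) / Gamma (?x i + \<alpha>))) = fact k * (Gamma (\<alpha> + \<beta>) / Gamma (?x k))"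
  proof (induction k)
    case 0
    show ?case
      using x[of 0] by (simp add: Gamma_real_pos less_imp_neq[symmetric])
  next
    case (Suc k)
    have "?x k + \<alpha> = ?x (Suc k)"
      by (simp add: algebra_simps)
    moreover have "Gamma (?x k) \<noteq> 0"
      using Gamma_real_pos[OF x[of k]] by simp
    ultimately show ?case
      by (simp only: prod.lessThan_Suc Suc) (simp add: algebra_simps)
  qed
  also have "real (Suc k) / real (Suc k) * (fact k * (Gamma (\<alpha> + \<beta>) / Gamma (?x k)))
      = gen_pochhammer 1 (real k) / gen_pochhammer (\<alpha> + \<beta>) (\<alpha> * real k)"
    using \<alpha> Gamma_real_pos[OF x[of 0]] by (auto simp: gen_pochhammer_def Gamma_fact simp del: of_nat_Suc)
  finally show ?thesis .
qed

theorem theoremA: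
  fixes \<alpha> \<beta> :: real and M :: "'a measure" and X :: "'a \<Rightarrow> real"
  assumes "0 \<le> \<alpha>" and "\<alpha> \<le> 1" and "0 \<le> \<beta>"
    and "is_M_variable \<alpha> \<beta> M X"
  shows "unimodal M X"
proof (cases "\<alpha> = 0")
  case True
  show ?thesis
  proof (rule unimodal_if_moments_limit[OF assms(4,1), where v = "\<lambda>_. fact" and R = 1])
    \<comment> \<open>As \<open>\<alpha> * real k = 0\<close>, the denominator is 1 by the first
      branch of \<open>gen_pochhammer\<close>; this includes \<beta> = 0, where Gamma is evaluated
      at its pole.\<close>
    show "(\<lambda>N. fact k) \<longlonglongrightarrow> gen_pochhammer 1 (real k) / gen_pochhammer (\<alpha> + \<beta>) (\<alpha> * real k)" for k
      using True by (auto simp: gen_pochhammer_def Gamma_fact)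
  qed (auto intro: unimodal_exponential_density)
next
  case False
  with assms have \<alpha>: "0 < \<alpha>"
    by simp
  \<comment> \<open>The offset 2 keeps \<open>q N\<close> strictly between 0 and 1 already at N =
    0.\<close>
  define q where "q = (\<lambda>N. 1 - 1 / real (N + 2))"
  have q: "0 < q N" "q N < 1" for N
    by (simp_all add: q_def)
  have "q \<longlonglongrightarrow> 1 - 0"
    unfolding q_def
    by (intro tendsto_diff tendsto_const LIMSEQ_ignore_initial_segment[OF lim_1_over_n])
  then have q_lim: "filterlim q (at_left 1) sequentially"
    unfolding filterlim_at using q(2) by (auto intro!: always_eventually less_imp_neq)
  have "\<exists>f. unimodal_positive_density f (step_moment \<alpha> \<beta> (q N))" for N
    using unimodal_step_density[OF \<alpha> assms(2,3) q] .
  then obtain f where f: "\<And>N. unimodal_positive_density (f N) (step_moment \<alpha> \<beta> (q N))"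
    by metis
  show ?thesis
  proof (rule unimodal_if_moments_limit[OF assms(4,1) f])
    show "step_moment \<alpha> \<beta> (q N) k \<le> fact k * (2 / \<alpha>) ^ k" for N k
      by (rule step_moment_le[OF \<alpha> assms(2,3) q])
    show "(\<lambda>N. step_moment \<alpha> \<beta> (q N) k)
        \<longlonglongrightarrow> gen_pochhammer 1 (real k) / gen_pochhammer (\<alpha> + \<beta>) (\<alpha> * real k)" for k
      by (rule filterlim_compose[OF step_moment_tendsto[OF \<alpha> assms(2,3)] q_lim])
  qed (use \<alpha> in simp)
qed

end
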